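(* Let $\langle X\mid R\rangle$ be a group presentation with Dehn function $\Delta$, and let $\Delta_0(n)=\max\{\mathrm{Area}(c):c\text{ is a proper corolla and }|c|\leqslant n\}$. Let $\alpha$ be a positive real number; then the Dehn function $\Delta$ is bounded by the linear function $\alpha n$ (i.e. $\Delta(n)\leqslant\alpha n$ for all $n$) if and only if $\Delta_0$ is (i.e. $\Delta_0(n)\leqslant\alpha n$ for all $n$).
   Context: $R$ is a set of non-empty cyclically reduced words with $R^{-1}\subset R$. A relator is a reduced word in the normal closure of $R$ in the free group $\mathcal F(X)$ (identified with the set of reduced words). $\mathrm{Area}(w)$ is the least $k$ such that the relator $w$ is the reduced form of a product of $k$ conjugates of elements of $R$. The Dehn function, defined for presentations with $X$ finite ($R$ may be infinite), is $\Delta(n)=\max\{\mathrm{Area}(w):w\text{ a relator},|w|\leqslant n\}$. For a word $u$ there are unique reduced $t$ and cyclically reduced $w$ such that the reduced form of $u$ is the word $twt^{-1}$; $w$ is the cyclically reduced form of $u$; $\pi(u,v)$ is the cyclically reduced form of $uv$. $w_2w_1$ is a cyclic conjugate of $w_1w_2$; $w_1uw_2$ is an insertion of $u$ into $w_1w_2$. $C_1$ is the set of cyclic conjugates of elements of $R$; for $k>1$, $C_k$ is the set of cyclic conjugates of the words $\pi(u,v)$ where (1) $u\in C_{k-1},v\in C_1$ or $u\in C_1,v\in C_{k-1}$; (2) $u\ne v^{-1}$; (3) either $u^{-1}$ is a prefix of $v$, or $v^{-1}$ is a suffix of $u$, or the last letter of $u$ is the inverse of the first of $v$ but the first letter of $u$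 is not the inverse of the last of $v$. $D_1$ is the set of reduced words of the form $uwu^{-1}$, $w\in C_1$ ($u$ possibly empty); for $k>1$, $D_k$ is the set of reduced words which are of the form $uwu^{-1}$ with $w\in C_k$ ($u$ possibly empty) or are insertions of a word of $D_i$ into a word of $D_j$ with $i,j\geqslant1$, $i+j=k$. A proper corolla is a word $c$ such that, for some $k$, $c\in C_k$ and $c\notin D_h$ for all $h<k$. *)

theory Defs
  imports Complex_Main "HOL-Library.Sublist" "HOL-Algebra.Coset"
begin

text \<open>The letter \<open>(x, b)\<close> stands for the generator \<open>x\<close> if \<open>b\<close> holds and for its
  formal inverse otherwise.\<close>

type_synonym 'a word = "('a \<times> bool) list"

definition inv_letter :: "'a \<times> bool \<Rightarrow> 'a \<times> bool" where
  "inv_letter a = (fst a, \<not> snd a)"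

definition inv_word :: "'a word \<Rightarrow> 'a word" where
  "inv_word w = rev (map inv_letter w)"

definition words :: "'a set \<Rightarrow> 'a word set" where
  "words X = lists (X \<times> UNIV)"

definition reduced :: "'a word \<Rightarrow> bool" where
  "reduced w \<longleftrightarrow> \<not> (\<exists>u a v. w = u @ [a, inv_letter a] @ v)"

definition cyc_reduced :: "'a word \<Rightarrow> bool" where
  "cyc_reduced w \<longleftrightarrow> reduced w \<and> (w \<noteq> [] \<longrightarrow> hd w \<noteq> inv_letter (last w))"

fun push_letter :: "'a \<times> bool \<Rightarrow> 'a word \<Rightarrow> 'a word" where
  "push_letter a [] = [a]"
| "push_letter a (b # w) = (if b = inv_letter a then w else a # b # w)"

definition red :: "'a word \<Rightarrow> 'a word" where
  "red w = foldr push_letter w []"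

definition free_group :: "'a set \<Rightarrow> 'a word monoid" where
  "free_group X =
     \<lparr>carrier = {w \<in> words X. reduced w}, mult = (\<lambda>u v. red (u @ v)), one = []\<rparr>"

definition normal_closure :: "('g, 'm) monoid_scheme \<Rightarrow> 'g set \<Rightarrow> 'g set" where
  "normal_closure G S = \<Inter> {N. N \<lhd> G \<and> S \<subseteq> N}"

definition presentation :: "'a set \<Rightarrow> 'a word set \<Rightarrow> bool" where
  "presentation X R \<longleftrightarrow>
     R \<subseteq> words X \<and> (\<forall>r\<in>R. r \<noteq> [] \<and> cyc_reduced r) \<and> inv_word ` R \<subseteq> R"

definition relators :: "'a set \<Rightarrow> 'a word set \<Rightarrow> 'a word set" where
  "relators X R = normal_closure (free_group X) R"

definition conj_product :: "('a word \<times> 'a word) list \<Rightarrow> 'a word" where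
  "conj_product ps = concat (map (\<lambda>(t, r). t @ r @ inv_word t) ps)"

definition area :: "'a set \<Rightarrow> 'a word set \<Rightarrow> 'a word \<Rightarrow> nat" where
  "area X R w =
     (LEAST k. \<exists>ps. set ps \<subseteq> words X \<times> R \<and> length ps = k \<and> w = red (conj_product ps))"

text \<open>For finite \<open>X\<close> the set below is finite, and it is non-empty because the empty word is a
  relator.\<close>

definition dehn :: "'a set \<Rightarrow> 'a word set \<Rightarrow> nat \<Rightarrow> nat" where
  "dehn X R n = Max {area X R w | w. w \<in> relators X R \<and> length w \<le> n}"

definition cyc_red :: "'a word \<Rightarrow> 'a word" where
  "cyc_red u = (THE w. cyc_reduced w \<and> (\<exists>t. reduced t \<and> red u = t @ w @ inv_word t))"

definition cyc_prod :: "'a word \<Rightarrow> 'a word \<Rightarrow> 'a word" where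
  "cyc_prod u v = cyc_red (u @ v)"

definition cyclic_conjugate :: "'a word \<Rightarrow> 'a word \<Rightarrow> bool" where
  "cyclic_conjugate v w \<longleftrightarrow> (\<exists>w1 w2. w = w1 @ w2 \<and> v = w2 @ w1)"

definition insertion :: "'a word \<Rightarrow> 'a word \<Rightarrow> 'a word \<Rightarrow> bool" where
  "insertion u v w \<longleftrightarrow> (\<exists>w1 w2. v = w1 @ w2 \<and> w = w1 @ u @ w2)"

text \<open>The index of \<open>C\<^sub>k\<close> and \<open>D\<^sub>k\<close> starts at 1; the sets with index 0 are empty.  If the
  elements of \<open>R\<close> are non-empty and cyclically reduced, all elements of \<open>C\<^sub>k\<close> are
  non-empty, so that \<open>hd\<close> and \<open>last\<close> are only applied to non-empty words.\<close>

fun C_set :: "'a word set \<Rightarrow> nat \<Rightarrow> 'a word set" where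
  "C_set R 0 = {}"
| "C_set R (Suc 0) = {w. \<exists>r\<in>R. cyclic_conjugate w r}"
| "C_set R (Suc (Suc k)) =
     {w. \<exists>u v.
        (u \<in> C_set R (Suc k) \<and> v \<in> C_set R (Suc 0) \<or>
         u \<in> C_set R (Suc 0) \<and> v \<in> C_set R (Suc k)) \<and>
        u \<noteq> inv_word v \<and>
        (prefix (inv_word u) v \<or> suffix (inv_word v) u \<or>
         last u = inv_letter (hd v) \<and> hd u \<noteq> inv_letter (last v)) \<and>
        cyclic_conjugate w (cyc_prod u v)}"

inductive in_D :: "'a set \<Rightarrow> 'a word set \<Rightarrow> nat \<Rightarrow> 'a word \<Rightarrow> bool"
  for X :: "'a set" and R :: "'a word set" where
  conj: "\<lbrakk>k \<ge> 1; w \<in> C_set R k; u \<in> words X; reduced (u @ w @ inv_word u)\<rbrakk>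
           \<Longrightarrow> in_D X R k (u @ w @ inv_word u)"
| ins: "\<lbrakk>i \<ge> 1; j \<ge> 1; in_D X R i u; in_D X R j v; insertion u v w; reduced w\<rbrakk>
           \<Longrightarrow> in_D X R (i + j) w"

definition D_set :: "'a set \<Rightarrow> 'a word set \<Rightarrow> nat \<Rightarrow> 'a word set" where
  "D_set X R k = {w. in_D X R k w}"

definition proper_corolla :: "'a set \<Rightarrow> 'a word set \<Rightarrow> 'a word \<Rightarrow> bool" where
  "proper_corolla X R c \<longleftrightarrow>
     (\<exists>k\<ge>1. c \<in> C_set R k \<and> (\<forall>h. 1 \<le> h \<and> h < k \<longrightarrow> c \<notin> D_set X R h))"

text \<open>There may be no proper corolla of length at most \<open>n\<close> (for instance if \<open>n = 0\<close>); the
  maximum of the empty set of areas is taken to be 0.\<close>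

definition corolla_dehn :: "'a set \<Rightarrow> 'a word set \<Rightarrow> nat \<Rightarrow> nat" where
  "corolla_dehn X R n =
     Max (insert 0 {area X R c | c. proper_corolla X R c \<and> length c \<le> n})"

lemma inv_letter_inv_letter [simp]: "inv_letter (inv_letter a) = a"
  by (simp add: inv_letter_def)

lemma inv_letter_neq [simp]: "inv_letter a \<noteq> a" "a \<noteq> inv_letter a"
  by (simp_all add: inv_letter_def prod_eq_iff)

lemma inv_word_simps [simp]:
  "inv_word [] = []" "inv_word (a # w) = inv_word w @ [inv_letter a]"
  "inv_word (u @ v) = inv_word v @ inv_word u" "inv_word (inv_word w) = w"
  by (simp_all add: inv_word_def rev_map comp_def)

lemma reduced_Nil [simp]: "reduced []"
  by (simp add: reduced_def)

lemma reduced_Cons: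
  "reduced (a # w) \<longleftrightarrow> reduced w \<and> (w \<noteq> [] \<longrightarrow> hd w \<noteq> inv_letter a)"
proof
  assume L: "reduced (a # w)"
  have "reduced w"
    unfolding reduced_def
  proof
    assume "\<exists>u b v. w = u @ [b, inv_letter b] @ v"
    then obtain u b v where "a # w = (a # u) @ [b, inv_letter b] @ v" by auto
    with L show False unfolding reduced_def by blast
  qed
  moreover have "hd w \<noteq> inv_letter a" if "w \<noteq> []"
  proof
    assume "hd w = inv_letter a"
    with that have "a # w = [] @ [a, inv_letter a] @ tl w" by (cases w) auto
    with L show False unfolding reduced_def by blast
  qed
  ultimately show "reduced w \<and> (w \<noteq> [] \<longrightarrow> hd w \<noteq> inv_letter a)" by blast
next
  assume R: "reduced w \<and> (w \<noteq> [] \<longrightarrow> hd w \<noteq> inv_letter a)"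
  show "reduced (a # w)"
    unfolding reduced_def
  proof
    assume "\<exists>u b v. a # w = u @ [b, inv_letter b] @ v"
    then obtain u b v where e: "a # w = u @ [b, inv_letter b] @ v" by blast
    show False
    proof (cases u)
      case Nil
      with e R show False by simp
    next
      case (Cons c u')
      with e have "w = u' @ [b, inv_letter b] @ v" by simp
      with R show False unfolding reduced_def by blast
    qed
  qed
qed

lemma reduced_push_letter: "reduced w \<Longrightarrow> reduced (push_letter a w)"
  by (cases w) (auto simp: reduced_Cons)

lemma reduced_foldr_push: "reduced v \<Longrightarrow> reduced (foldr push_letter u v)"
  by (induction u) (auto intro: reduced_push_letter)

lemma reduced_red: "reduced (red w)"
  by (simp add: red_def reduced_foldr_push)

lemma red_reduced: "reduced w \<Longrightarrow> red w = w"
proof (induction w)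
  case (Cons a w)
  then show ?case by (cases w) (auto simp: reduced_Cons red_def)
qed (simp add: red_def)

lemma push_letter_cancel:
  assumes "reduced w"
  shows "push_letter a (push_letter (inv_letter a) w) = w"
proof (cases w)
  case (Cons b w')
  with assms show ?thesis by (cases w') (auto simp: reduced_Cons)
qed simp

lemma foldr_push_push:
  assumes "reduced v"
  shows "foldr push_letter (push_letter a s) v = push_letter a (foldr push_letter s v)"
  by (cases s) (auto simp: push_letter_cancel reduced_foldr_push assms)

lemma foldr_push_red: "reduced v \<Longrightarrow> foldr push_letter (red u) v = foldr push_letter u v"
  by (induction u) (auto simp: red_def foldr_push_push)

lemma red_append_red: "red (red u @ v) = red (u @ v)" "red (u @ red v) = red (u @ v)"
  by (auto simp: red_def foldr_push_red[unfolded red_def] reduced_foldr_push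
      red_reduced[unfolded red_def])

lemma red_inv_word: "red (inv_word w @ w) = []"
proof (induction w)
  case (Cons a w)
  have "red (inv_word (a # w) @ a # w) =
      foldr push_letter (inv_word w) (push_letter (inv_letter a) (push_letter a (red w)))"
    by (simp add: red_def)
  also have "push_letter (inv_letter a) (push_letter a (red w)) = red w"
    using push_letter_cancel[OF reduced_red, of "inv_letter a" w] by simp
  finally show ?case using Cons by (simp add: red_def)
qed (simp add: red_def)

lemma reduced_append_Cons_Cons:
  "reduced (u @ a # b # v) \<longleftrightarrow> reduced (u @ [a]) \<and> b \<noteq> inv_letter a \<and> reduced (b # v)"
proof (induction u)
  case (Cons c u)
  then show ?case by (cases u) (auto simp: reduced_Cons)
qed (auto simp: reduced_Cons)

lemma reduced_appendD: assumes "reduced (u @ v)" shows "reduced u" "reduced v"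
  using assms unfolding reduced_def by (metis append.assoc)+

lemma reduced_inv_word: "reduced w \<Longrightarrow> reduced (inv_word w)"
proof (induction w)
  case (Cons a w)
  then show ?case
    by (cases w) (auto simp: reduced_Cons reduced_append_Cons_Cons)
qed simp

lemma words_simps [simp]:
  "[] \<in> words X" "a # w \<in> words X \<longleftrightarrow> fst a \<in> X \<and> w \<in> words X"
  "u @ v \<in> words X \<longleftrightarrow> u \<in> words X \<and> v \<in> words X"
  by (auto simp: words_def mem_Times_iff)

lemma inv_word_words: "w \<in> words X \<Longrightarrow> inv_word w \<in> words X"
  by (induction w) (auto simp: inv_letter_def)

lemma red_words: "w \<in> words X \<Longrightarrow> red w \<in> words X"
proof (induction w)
  case (Cons a w)
  then show ?case by (cases "red w") (auto simp: red_def)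
qed (simp add: red_def)

lemma group_free_group: "group (free_group X)"
proof (rule groupI)
  fix x assume "x \<in> carrier (free_group X)"
  then show "\<exists>y\<in>carrier (free_group X). y \<otimes>\<^bsub>free_group X\<^esub> x = \<one>\<^bsub>free_group X\<^esub>"
    by (intro bexI[of _ "inv_word x"])
      (auto simp: free_group_def red_inv_word reduced_inv_word inv_word_words)
qed (auto simp: free_group_def reduced_red red_words red_reduced red_append_red)

lemma cyc_decomp_ex:
  "reduced u \<Longrightarrow> \<exists>w t. cyc_reduced w \<and> reduced t \<and> u = t @ w @ inv_word t"
proof (induction u rule: length_induct)
  case (1 u)
  show ?case
  proof (cases "cyc_reduced u")
    case True
    then show ?thesis by (intro exI[of _ u] exI[of _ "[]"]) simp
  next
    case False
    with 1 have ne: "u \<noteq> []" and h: "hd u = inv_letter (last u)" by (auto simp: cyc_reduced_def)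
    obtain a v where v: "u = a # v" using ne by (cases u) auto
    have "v \<noteq> []" using h v by auto
    then obtain u' b where u': "v = u' @ [b]" by (metis rev_exhaust)
    have b: "b = inv_letter a" using h v u' by simp
    have "reduced u'" using "1.prems" v u' by (metis reduced_Cons reduced_appendD(1))
    then obtain w t where wt: "cyc_reduced w" "reduced t" "u' = t @ w @ inv_word t"
      using "1.IH"[rule_format, of u'] v u' by auto
    have u: "u = (a # t) @ w @ inv_word (a # t)" using v u' b wt by simp
    have "reduced (a # t)" using "1.prems" u reduced_appendD(1) by metis
    then show ?thesis using wt u by blast
  qed
qed

lemma cyc_decomp_unique:
  "\<lbrakk>cyc_reduced w; cyc_reduced w'; reduced (t @ w @ inv_word t);
    t @ w @ inv_word t = t' @ w' @ inv_word t'\<rbrakk> \<Longrightarrow> w = w'"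
proof (induction t arbitrary: t')
  case Nil
  show ?case
  proof (cases t')
    case (Cons a s)
    with Nil show ?thesis by (auto simp: cyc_reduced_def)
  qed (use Nil in simp)
next
  case (Cons a s)
  show ?case
  proof (cases t')
    case Nil
    with Cons.prems have e: "w' = a # (s @ w @ inv_word s) @ [inv_letter a]" by simp
    have "hd w' = inv_letter (last w')" unfolding e by simp
    with Cons.prems e show ?thesis by (auto simp: cyc_reduced_def)
  next
    case (Cons b s')
    with Cons.prems have e: "s @ w @ inv_word s = s' @ w' @ inv_word s'"
      by (simp flip: append_assoc)
    have "reduced (s @ w @ inv_word s)"
      using Cons.prems(3) reduced_appendD(1)[of "s @ w @ inv_word s" "[inv_letter a]"]
      by (simp add: reduced_Cons)
    with Cons.IH Cons.prems e show ?thesis by blast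
  qed
qed

lemma cyc_red_ex1: "\<exists>!w. cyc_reduced w \<and> (\<exists>t. reduced t \<and> red u = t @ w @ inv_word t)"
proof -
  obtain w t where wt: "cyc_reduced w" "reduced t" "red u = t @ w @ inv_word t"
    using cyc_decomp_ex[OF reduced_red[of u]] by blast
  have "w' = w" if "cyc_reduced w'" "red u = t' @ w' @ inv_word t'" for w' t'
  proof (rule cyc_decomp_unique[OF that(1) wt(1)])
    show "reduced (t' @ w' @ inv_word t')" using reduced_red[of u] unfolding that(2) .
    show "t' @ w' @ inv_word t' = t @ w @ inv_word t" by (rule trans[OF that(2)[symmetric] wt(3)])
  qed
  with wt show ?thesis by metis
qed

end

theory Submission
  imports Defs
begin

text \<open>
  Call a relator simple if it is cyclically reduced and no proper non-empty cyclic subword of it is a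
  relator.  By induction on the length, a linear bound on the area only has to be checked on simple
  relators, since every other relator is a conjugate of a shorter one or splits into two shorter
  ones.  The key point is that a simple relator \<open>w\<close> belongs to some \<open>C\<^sub>k\<close>; unless it is a proper
  corolla it then also lies in some \<open>D\<^sub>h\<close> with \<open>h < k\<close>, and the bound follows by induction on \<open>k\<close>.

  To see this, write \<open>w\<close> as a product of conjugates of words \<open>c\<^sub>i \<in> C\<^bsub>k i\<^esub>\<close> such that \<open>N = \<Sum> k\<^sub>i\<close> is minimal and,
  among these products, \<open>W = \<Sum> 3 ^ k\<^sub>i\<close> is maximal.  Two factors of an optimal product cannot be glued
  along a letter: if \<open>c \<in> C\<^sub>k\<close> ends with the inverse of the first letter of \<open>d \<in> C\<^sub>l\<close> and \<open>l \<le> k\<close>, then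
  \<open>d\<close> can be broken up into \<open>l\<close> conjugates of words of \<open>C\<^sub>1\<close>, one of which merges with \<open>c\<close> to a word of \<open>C\<^bsub>k+1\<^esub>\<close>
  or cancels it, and \<open>3 ^ (k + 1) > 3 ^ k + 3 ^ l\<close>.  On the other hand, every letter of a reduced
  relator either lies on one of the factors or is a bridge of the van Kampen diagram, that is, it is
  paired with an inverse letter such that both words between them are relators and
  share the factors.  Applying this first to \<open>w\<close> and then to the complement of a factor
  sharing a letter with \<open>w\<close> shows that an optimal product for a simple relator has only one factor.
\<close>

section \<open>Words\<close>

lemma append_eq_append_Cons_cases:
  assumes "u @ v = p @ b # q"
  obtains r where "u = p @ b # r" "q = r @ v" | r where "p = u @ r" "v = r @ b # q"
proof -
  from assms consider r where "u = p @ r" "r @ v = b # q" | r where "u @ r = p" "v = r @ b # q"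
    by (auto simp: append_eq_append_conv2)
  then show ?thesis
    using that by cases (auto simp: append_eq_Cons_conv)
qed

lemma common_prefix_ex:
  "\<exists>z u' v'. u = z @ u' \<and> v = z @ v' \<and> (u' \<noteq> [] \<and> v' \<noteq> [] \<longrightarrow> hd u' \<noteq> hd v')"
proof (induction u v rule: list_induct2')
  case (4 a u b v)
  show ?case
  proof (cases "a = b")
    case True
    with 4 show ?thesis by (metis append_Cons)
  qed (force intro: exI[of _ "[]"])
qed auto

lemma common_suffix_ex:
  "\<exists>z u' v'. u = u' @ z \<and> v = v' @ z \<and> (u' \<noteq> [] \<and> v' \<noteq> [] \<longrightarrow> last u' \<noteq> last v')"
proof -
  obtain z u' v' where "rev u = z @ u'" "rev v = z @ v'" "u' \<noteq> [] \<and> v' \<noteq> [] \<longrightarrow> hd u' \<noteq> hd v'"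
    using common_prefix_ex[of "rev u" "rev v"] by blast
  then show ?thesis
    by (intro exI[of _ "rev z"] exI[of _ "rev u'"] exI[of _ "rev v'"])
      (auto simp: last_rev simp flip: rev_append intro: rev_swap[THEN iffD1])
qed

lemma inv_letter_eq_iff [simp]: "inv_letter a = inv_letter b \<longleftrightarrow> a = b"
  by (metis inv_letter_inv_letter)

lemma inv_word_eq_Nil_iff [simp]: "inv_word w = [] \<longleftrightarrow> w = []"
  by (simp add: inv_word_def)

lemma hd_inv_word: "w \<noteq> [] \<Longrightarrow> hd (inv_word w) = inv_letter (last w)"
  by (simp add: inv_word_def hd_rev last_map)

lemma last_inv_word: "w \<noteq> [] \<Longrightarrow> last (inv_word w) = inv_letter (hd w)"
  by (simp add: inv_word_def last_rev hd_map)

lemma reduced_append: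
  "reduced (u @ v) \<longleftrightarrow>
     reduced u \<and> reduced v \<and> (u \<noteq> [] \<and> v \<noteq> [] \<longrightarrow> hd v \<noteq> inv_letter (last u))"
proof (induction u)
  case (Cons a u)
  then show ?case by (cases u) (auto simp: reduced_Cons)
qed simp

text \<open>Reduction works from the right end, so a cancellation always takes place behind the
  letters that are still unread. The prefix \<open>p\<close> stands for these letters and varies in
  the induction.\<close>

lemma red_induct [consumes 1, case_names cancel]:
  assumes "P (p @ w)" and del: "\<And>p a q. P (p @ a # inv_letter a # q) \<Longrightarrow> P (p @ q)"
  shows "P (p @ red w)"
  using assms(1)
proof (induction w arbitrary: p)
  case (Cons a w)
  from Cons.IH[of "p @ [a]"] Cons.prems have "P (p @ a # red w)" by simp
  moreover have "red (a # w) = push_letter a (red w)" by (simp add: red_def)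
  ultimately show ?case
    using del[of p a "red (a # w)"] by (cases "red w") (auto split: if_splits)
qed (simp add: red_def)

lemma cyc_red_decomp:
  obtains t where "cyc_reduced (cyc_red u)" "red u = t @ cyc_red u @ inv_word t"
  using theI'[OF cyc_red_ex1[of u], folded cyc_red_def] by blast

text \<open>In the decomposition of \<open>red w\<close>, rotating \<open>t\<close> to the end puts
  \<open>inv_word t @ t\<close> behind the cyclic core; this cancels pair by pair from the
  middle.\<close>

lemma cyc_red_induct [consumes 1, case_names cancel rotate]:
  assumes "P w" and del: "\<And>p a q. P (p @ a # inv_letter a # q) \<Longrightarrow> P (p @ q)"
    and rot: "\<And>u v. P (u @ v) \<Longrightarrow> P (v @ u)"
  shows "P (cyc_red w)"
proof -
  obtain t where t: "red w = t @ cyc_red w @ inv_word t"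
    using cyc_red_decomp by blast
  have "P (red w)"
    using red_induct[where P=P and p="[]" and w=w] assms(1) del by auto
  then have "P ((cyc_red w @ inv_word t) @ t)"
    using rot[of t "cyc_red w @ inv_word t"] by (simp add: t)
  then have "P (cyc_red w @ inv_word t @ t)" by simp
  then show ?thesis
  proof (induction t)
    case (Cons a t)
    then show ?case
      using del[of "cyc_red w @ inv_word t" "inv_letter a" t] by simp
  qed simp
qed

section \<open>The free group as an additive group type\<close>

text \<open>The free group on all letters of the type. With a type in place of a carrier set,
  identities between products of conjugates become plain rewriting; the additive notation does not
  mean commutativity.\<close>

typedef 'a fg = "{w :: 'a word. reduced w}" morphisms rep_fg abs_fg
  by (rule exI[of _ "[]"]) simp

definition cl :: "'a word \<Rightarrow> 'a fg" where
  "cl w = abs_fg (red w)"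

lemma cl_eq_iff: "cl u = cl v \<longleftrightarrow> red u = red v"
  by (simp add: cl_def abs_fg_inject reduced_red)

lemma cl_rep: "cl (rep_fg g) = g"
  using rep_fg[of g] by (simp add: cl_def red_reduced rep_fg_inverse)

lemma rep_cl: "rep_fg (cl w) = red w"
  by (simp add: cl_def abs_fg_inverse reduced_red)

instantiation fg :: (type) group_add
begin

definition "0 = cl []"
definition "g + h = cl (rep_fg g @ rep_fg h)"
definition "- g = cl (inv_word (rep_fg g))"
definition "(g :: 'a fg) - h = g + - h"

instance
proof
  fix a b c :: "'a fg"
  show "a + b + c = a + (b + c)"
    by (simp add: plus_fg_def rep_cl cl_eq_iff red_append_red)
  show "0 + a = a" "a + 0 = a"
    by (simp_all add: plus_fg_def zero_fg_def rep_cl red_def cl_rep)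
  show "- a + a = 0"
    by (simp add: plus_fg_def zero_fg_def uminus_fg_def rep_cl cl_eq_iff red_append_red red_inv_word)
      (simp add: red_def)
qed (simp add: minus_fg_def)

end

definition lt :: "'a \<times> bool \<Rightarrow> 'a fg" where
  "lt a = cl [a]"

lemma cl_Nil: "cl [] = 0"
  by (simp add: zero_fg_def)

lemma cl_append: "cl (u @ v) = cl u + cl v"
  by (simp add: plus_fg_def rep_cl cl_eq_iff red_append_red)

lemma cl_Cons: "cl (a # w) = lt a + cl w"
  using cl_append[of "[a]" w] by (simp add: lt_def)

lemma cl_inv_word: "cl (inv_word w) = - cl w"
proof -
  have "cl (inv_word w) + cl w = 0"
    by (simp add: cl_append[symmetric] zero_fg_def cl_eq_iff red_inv_word) (simp add: red_def)
  then show ?thesis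
    by (simp add: eq_neg_iff_add_eq_0)
qed

lemma cl_inv_letter: "lt (inv_letter a) = - lt a"
  using cl_inv_word[of "[a]"] by (simp add: lt_def)

lemma cl_red [simp]: "cl (red w) = cl w"
  by (simp add: cl_eq_iff red_reduced reduced_red)

lemma cl_eq_reduced: "cl u = cl v \<Longrightarrow> reduced u \<Longrightarrow> reduced v \<Longrightarrow> u = v"
  by (simp add: cl_eq_iff red_reduced)

lemma cl_eq_0_iff: "cl w = 0 \<longleftrightarrow> red w = []"
  by (simp add: zero_fg_def cl_eq_iff red_reduced)

text \<open>Sums are associated to the right, differences expanded and adjacent inverses cancelled.
  The default rewriting of \<open>a + - b\<close> to \<open>a - b\<close> would interfere, hence the
  frequent \<open>simp only\<close>.\<close>

lemmas fg_simps = cl_Nil cl_append cl_Cons cl_inv_word cl_inv_letter add.assoc minus_add minus_minus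
  add_0_left add_0_right left_minus right_minus minus_add_cancel add_minus_cancel minus_zero
  diff_conv_add_uminus append_Cons append_Nil append_assoc inv_word_simps inv_letter_inv_letter

section \<open>Products of conjugates of words of \<open>C\<^sub>k\<close>\<close>

text \<open>\<open>crep R N W g\<close>: \<open>g\<close> is a product of conjugates of words of sets \<open>C\<^sub>k\<close>, where \<open>N\<close> is the sum of the
  indices \<open>k\<close> and \<open>W\<close> the sum of the weights \<open>3 ^ k\<close>.\<close>

inductive crep :: "'a word set \<Rightarrow> nat \<Rightarrow> nat \<Rightarrow> 'a fg \<Rightarrow> bool" for R where
  zero: "crep R 0 0 0"
| step: "\<lbrakk>crep R N W g; c \<in> C_set R k\<rbrakk> \<Longrightarrow> crep R (N + k) (W + 3 ^ k) (x + cl c + - x + g)"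

definition better :: "nat \<times> nat \<Rightarrow> nat \<times> nat \<Rightarrow> bool" where
  "better p q \<longleftrightarrow> fst p < fst q \<or> fst p = fst q \<and> snd q < snd p"

lemma better_add: "better (N, W) (N', W') \<Longrightarrow> better (N + n, W + m) (N' + n, W' + m)"
  by (auto simp: better_def)

section \<open>Rotations, and the calculus of products\<close>

lemma cyclic_conjugate_refl [simp]: "cyclic_conjugate w w"
  unfolding cyclic_conjugate_def by (metis append_Nil append_Nil2)

lemma cyclic_conjugate_rotate [simp]: "cyclic_conjugate (v @ u) (u @ v)"
  unfolding cyclic_conjugate_def by blast

lemma cyclic_conjugate_trans:
  assumes "cyclic_conjugate u v" "cyclic_conjugate v w"
  shows "cyclic_conjugate u w"
proof -
  obtain p q where v: "v = p @ q" and u: "u = q @ p"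
    using assms(1) by (auto simp: cyclic_conjugate_def)
  obtain r s where w: "w = r @ s" and v': "v = s @ r"
    using assms(2) by (auto simp: cyclic_conjugate_def)
  from v v' consider t where "p = s @ t" "r = t @ q" | t where "s = p @ t" "q = t @ r"
    by (auto simp: append_eq_append_conv2)
  then show ?thesis
  proof cases
    case 1
    then have "w = t @ (q @ s)" "u = (q @ s) @ t" using u w by simp_all
    then show ?thesis by (metis cyclic_conjugate_rotate)
  next
    case 2
    then have "w = (r @ p) @ t" "u = t @ (r @ p)" using u w by simp_all
    then show ?thesis by (metis cyclic_conjugate_rotate)
  qed
qed

lemma cyc_reduced_rotate: "cyc_reduced (u @ v) \<Longrightarrow> cyc_reduced (v @ u)"
  by (cases "u = []"; cases "v = []")
    (auto simp: cyc_reduced_def reduced_append)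

lemma C_set_rotate: "u @ v \<in> C_set R k \<Longrightarrow> v @ u \<in> C_set R k"
proof (induction R k rule: C_set.induct)
  case (2 R)
  then show ?case
    using cyclic_conjugate_trans[OF cyclic_conjugate_rotate[of v u]] by auto
next
  case (3 R k)
  then show ?case
    using cyclic_conjugate_trans[OF cyclic_conjugate_rotate[of v u]] by simp blast
qed simp

lemma C_set_pos: "w \<in> C_set R k \<Longrightarrow> k \<ge> 1"
  by (cases k) auto

lemma crep_add: "crep R N W g \<Longrightarrow> crep R N' W' h \<Longrightarrow> crep R (N + N') (W + W') (g + h)"
proof (induction rule: crep.induct)
  case (step N W g c k x)
  from crep.step[OF step.IH[OF step.prems] step.hyps(2), of x] show ?case
    by (simp add: ac_simps fg_simps del: add_uminus_conv_diff)
qed simp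

lemma crep_conj: "crep R N W g \<Longrightarrow> crep R N W (x + g + - x)"
proof (induction rule: crep.induct)
  case (step N W g c k y)
  from crep.step[OF step.IH step.hyps(2), of "x + y"] show ?case
    by (simp only: fg_simps)
qed (simp add: crep.zero)

lemma crep_rotate:
  assumes "crep R N W (g + h)"
  shows "crep R N W (h + g)"
  using crep_conj[OF assms, of "- g"] by (simp only: fg_simps)

text \<open>Inserting \<open>f\<close> amounts to multiplying \<open>g + h\<close> on the left by
  the conjugate \<open>g + f + - g\<close>.\<close>

lemma crep_insert:
  assumes "crep R N W (g + h)" "crep R N' W' f"
  shows "crep R (N + N') (W + W') (g + (f + h))"
  using crep_add[OF crep_conj[OF assms(2), of g] assms(1)] by (simp only: fg_simps ac_simps)

lemma crep_C_set:
  assumes "c \<in> C_set R k"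
  shows "crep R k (3 ^ k) (cl c)"
  using crep.step[OF crep.zero assms, of 0] by simp

lemma crep_eq_0: "crep R N W g \<Longrightarrow> N = 0 \<Longrightarrow> g = 0 \<and> W = 0"
  by (induction rule: crep.induct) (auto dest: C_set_pos)

text \<open>This bounds the weights for a fixed index sum, so that a product of maximal weight
  exists. Two powers of 3 with positive exponents have a sum at most their product;
  \<open>N = 0\<close> leaves only the empty product.\<close>

lemma crep_weight_le: "crep R N W g \<Longrightarrow> W \<le> 3 ^ N"
proof (induction rule: crep.induct)
  case (step N W g c k x)
  show ?case
  proof (cases "N = 0")
    case True
    with crep_eq_0[OF step.hyps(1)] show ?thesis by simp
  next
    case False
    obtain n m where nm: "N = Suc n" "k = Suc m"
      using False C_set_pos[OF step.hyps(2)] by (cases N; cases k) auto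
    have "(3::nat) ^ N + 3 ^ k \<le> 3 ^ N * 3 ^ k"
    proof -
      have "a + b \<le> 3 * (a * b)" if "a \<ge> 1" "b \<ge> 1" for a b :: nat
        using that mult_le_mono[of a a 1 b] mult_le_mono[of 1 a b b] by linarith
      from this[of "3 ^ n" "3 ^ m"] show ?thesis by (simp add: nm)
    qed
    with step.IH show ?thesis by (simp add: power_add)
  qed
qed simp

lemma cl_cyc_red: "\<exists>t. cl w = t + cl (cyc_red w) + - t"
  using cyc_red_decomp[of w] by (metis cl_append cl_inv_word cl_red add.assoc)

lemma C_set_Suc:
  assumes "k \<ge> 1"
  shows "C_set R (Suc k) =
     {w. \<exists>u v.
        (u \<in> C_set R k \<and> v \<in> C_set R 1 \<or> u \<in> C_set R 1 \<and> v \<in> C_set R k) \<and>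
        u \<noteq> inv_word v \<and>
        (prefix (inv_word u) v \<or> suffix (inv_word v) u \<or>
         last u = inv_letter (hd v) \<and> hd u \<noteq> inv_letter (last v)) \<and>
        cyclic_conjugate w (cyc_prod u v)}"
proof -
  from assms obtain l where "k = Suc l" by (cases k) auto
  then show ?thesis by (simp only: C_set.simps(3) One_nat_def)
qed

lemma C_set_cases [consumes 1, case_names rel prod]:
  assumes "w \<in> C_set R k"
  obtains r where "k = 1" "r \<in> R" "cyclic_conjugate w r"
  | l u v where "k = Suc l" "l \<ge> 1"
      "u \<in> C_set R l \<and> v \<in> C_set R 1 \<or> u \<in> C_set R 1 \<and> v \<in> C_set R l"
      "u \<noteq> inv_word v" "cyclic_conjugate w (cyc_prod u v)"
proof (cases "k = 1")
  case True
  with assms that(1) show ?thesis by auto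
next
  case False
  with C_set_pos[OF assms] obtain l where "k = Suc l" "l \<ge> 1" by (cases k) auto
  with assms that(2) show ?thesis using C_set_Suc[OF \<open>l \<ge> 1\<close>, of R] by blast
qed

section \<open>The words of \<open>C\<^sub>k\<close> for a fixed presentation\<close>

locale word_presentation =
  fixes X :: "'a set" and R :: "'a word set"
  assumes pres: "presentation X R"
begin

lemma C_set_cyc_reduced:
  assumes "w \<in> C_set R k"
  shows "cyc_reduced w"
proof -
  have rot: "cyc_reduced v \<Longrightarrow> cyclic_conjugate w v \<Longrightarrow> cyc_reduced w" for v
    unfolding cyclic_conjugate_def using cyc_reduced_rotate by blast
  from assms show ?thesis
  proof (cases rule: C_set_cases)
    case (rel r)
    with pres show ?thesis by (auto simp: presentation_def intro: rot)
  next
    case (prod l u v)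
    then show ?thesis using cyc_red_decomp[of "u @ v"] rot by (auto simp: cyc_prod_def)
  qed
qed

lemma C_set_reduced: "w \<in> C_set R k \<Longrightarrow> reduced w"
  using C_set_cyc_reduced by (auto simp: cyc_reduced_def)

text \<open>If \<open>cyc_prod u v\<close> were empty, the reduced words \<open>u\<close> and
  \<open>v\<close> would represent inverse elements and so be formal inverses, which the definition
  of \<open>C_set\<close> excludes.\<close>

lemma C_set_neq_Nil:
  assumes "w \<in> C_set R k"
  shows "w \<noteq> []"
  using assms
proof (cases rule: C_set_cases)
  case (rel r)
  with pres show ?thesis by (auto simp: presentation_def cyclic_conjugate_def)
next
  case (prod l u v)
  then have red: "reduced u" "reduced v" using C_set_reduced by blast+
  have "cyc_prod u v \<noteq> []"
  proof
    assume "cyc_prod u v = []"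
    then have "cl u + cl v = 0"
      using cl_cyc_red[of "u @ v"] by (auto simp: cyc_prod_def fg_simps)
    then have "cl u = cl (inv_word v)"
      by (simp add: cl_inv_word eq_neg_iff_add_eq_0)
    with red prod(4) show False
      using cl_eq_reduced reduced_inv_word by blast
  qed
  with prod(5) show ?thesis by (auto simp: cyclic_conjugate_def)
qed

text \<open>Every letter of \<open>w\<close> is a letter of a factor from \<open>C\<^sub>1\<close>, in some product of \<open>l\<close> such factors;
  the equation \<open>w = p @ b # q\<close> is read cyclically.\<close>

definition unit_covered :: "nat \<Rightarrow> 'a word \<Rightarrow> bool" where
  "unit_covered l w \<longleftrightarrow> crep R l (3 * l) (cl w) \<and>
     (\<forall>p b q. w = p @ b # q \<longrightarrow>
        (\<exists>s. b # s \<in> C_set R 1 \<and> crep R (l - 1) (3 * (l - 1)) (- cl s + cl q + cl p)))"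

text \<open>A letter keeps the factor that it has in its own word; the product for the other word is
  inserted into the remainder.\<close>

lemma unit_covered_append:
  assumes "unit_covered l u" "unit_covered m v" "l \<ge> 1" "m \<ge> 1"
  shows "unit_covered (l + m) (u @ v)"
  unfolding unit_covered_def
proof (intro conjI allI impI)
  have u: "crep R l (3 * l) (cl u)" and v: "crep R m (3 * m) (cl v)"
    using assms by (auto simp: unit_covered_def)
  then show "crep R (l + m) (3 * (l + m)) (cl (u @ v))"
    using crep_add by (fastforce simp: cl_append algebra_simps)
  fix p b q assume "u @ v = p @ b # q"
  then show "\<exists>s. b # s \<in> C_set R 1 \<and>
      crep R (l + m - 1) (3 * (l + m - 1)) (- cl s + cl q + cl p)"
  proof (cases rule: append_eq_append_Cons_cases)
    case (1 r)
    then obtain s where s: "b # s \<in> C_set R 1" "crep R (l - 1) (3 * (l - 1)) (- cl s + cl r + cl p)"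
      using assms(1) unfolding unit_covered_def by blast
    have "crep R (l - 1 + m) (3 * (l - 1) + 3 * m) (- cl s + cl r + (cl v + cl p))"
      using crep_insert[OF s(2) v] .
    moreover have "l - 1 + m = l + m - 1" "3 * (l - 1) + 3 * m = 3 * (l + m - 1)"
      using assms(3) by linarith+
    ultimately have "crep R (l + m - 1) (3 * (l + m - 1)) (- cl s + cl q + cl p)"
      using 1 by (simp only: cl_append add.assoc)
    with s(1) show ?thesis by blast
  next
    case (2 r)
    then obtain s where s: "b # s \<in> C_set R 1" "crep R (m - 1) (3 * (m - 1)) (- cl s + cl q + cl r)"
      using assms(2) unfolding unit_covered_def by blast
    have "crep R (m - 1 + l) (3 * (m - 1) + 3 * l) (- cl s + cl q + (cl u + cl r))"
      using crep_insert[OF s(2) u] .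
    moreover have "m - 1 + l = l + m - 1" "3 * (m - 1) + 3 * l = 3 * (l + m - 1)"
      using assms(4) by linarith+
    ultimately have "crep R (l + m - 1) (3 * (l + m - 1)) (- cl s + cl q + cl p)"
      using 2 by (simp only: cl_append add.assoc)
    with s(1) show ?thesis by blast
  qed
qed

lemma unit_covered_cancel:
  assumes "unit_covered l (p @ a # inv_letter a # q)"
  shows "unit_covered l (p @ q)"
  unfolding unit_covered_def
proof (intro conjI allI impI)
  show "crep R l (3 * l) (cl (p @ q))"
    using assms by (auto simp: unit_covered_def fg_simps simp del: add_uminus_conv_diff)
  fix p' b q' assume "p @ q = p' @ b # q'"
  then show "\<exists>s. b # s \<in> C_set R 1 \<and> crep R (l - 1) (3 * (l - 1)) (- cl s + cl q' + cl p')"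
  proof (cases rule: append_eq_append_Cons_cases)
    case (1 r)
    then have "p @ a # inv_letter a # q = p' @ b # (r @ a # inv_letter a # q)" by simp
    with assms obtain s where "b # s \<in> C_set R 1"
        "crep R (l - 1) (3 * (l - 1)) (- cl s + cl (r @ a # inv_letter a # q) + cl p')"
      unfolding unit_covered_def by blast
    with 1 show ?thesis by (intro exI[of _ s]) (simp only: fg_simps simp_thms)
  next
    case (2 r)
    then have "p @ a # inv_letter a # q = (p @ a # inv_letter a # r) @ b # q'" by simp
    with assms obtain s where "b # s \<in> C_set R 1"
        "crep R (l - 1) (3 * (l - 1)) (- cl s + cl q' + cl (p @ a # inv_letter a # r))"
      unfolding unit_covered_def by blast
    with 2 show ?thesis by (intro exI[of _ s]) (simp only: fg_simps simp_thms)
  qed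
qed

lemma unit_covered_rotate:
  assumes "unit_covered l (u @ v)"
  shows "unit_covered l (v @ u)"
  unfolding unit_covered_def
proof (intro conjI allI impI)
  show "crep R l (3 * l) (cl (v @ u))"
    using assms crep_rotate by (auto simp: unit_covered_def cl_append)
  fix p b q assume "v @ u = p @ b # q"
  then show "\<exists>s. b # s \<in> C_set R 1 \<and> crep R (l - 1) (3 * (l - 1)) (- cl s + cl q + cl p)"
  proof (cases rule: append_eq_append_Cons_cases)
    case (1 r)
    then have "u @ v = (u @ p) @ b # r" by simp
    with assms obtain s where "b # s \<in> C_set R 1"
        "crep R (l - 1) (3 * (l - 1)) (- cl s + cl r + cl (u @ p))"
      unfolding unit_covered_def by blast
    with 1 show ?thesis by (intro exI[of _ s]) (simp only: fg_simps simp_thms)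
  next
    case (2 r)
    then have "u @ v = r @ b # (q @ v)" by simp
    with assms obtain s where "b # s \<in> C_set R 1"
        "crep R (l - 1) (3 * (l - 1)) (- cl s + cl (q @ v) + cl r)"
      unfolding unit_covered_def by blast
    with 2 show ?thesis by (intro exI[of _ s]) (simp only: fg_simps simp_thms)
  qed
qed

lemma unit_covered_cyclic_conjugate:
  "unit_covered l w \<Longrightarrow> cyclic_conjugate v w \<Longrightarrow> unit_covered l v"
  by (auto simp: cyclic_conjugate_def intro: unit_covered_rotate)

lemma unit_covered_1: "w \<in> C_set R 1 \<Longrightarrow> unit_covered 1 w"
  unfolding unit_covered_def
proof (intro conjI allI impI)
  assume w: "w \<in> C_set R 1"
  then show "crep R 1 (3 * 1) (cl w)" using crep_C_set by fastforce
  fix p b q assume "w = p @ b # q"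
  with w have "b # q @ p \<in> C_set R 1" using C_set_rotate[of p "b # q" R 1] by simp
  then show "\<exists>s. b # s \<in> C_set R 1 \<and> crep R (1 - 1) (3 * (1 - 1)) (- cl s + cl q + cl p)"
    by (intro exI[of _ "q @ p"]) (simp add: crep.zero fg_simps del: add_uminus_conv_diff)
qed

text \<open>Beyond index 1, a word of \<open>C_set\<close> arises from a concatenation
  \<open>u @ v\<close> by cancellations and rotations, all of which preserve the covering. Thus it
  can be broken up around any chosen letter.\<close>

lemma unit_covered_C_set: "w \<in> C_set R k \<Longrightarrow> unit_covered k w"
proof (induction k arbitrary: w)
  case (Suc k)
  from Suc.prems show ?case
  proof (cases rule: C_set_cases)
    case (rel r)
    with Suc.prems unit_covered_1 show ?thesis by simp
  next
    case (prod l u v)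
    then have "unit_covered (Suc k) (u @ v)"
      using unit_covered_append[of k u 1 v] unit_covered_append[of 1 u k v] Suc.IH unit_covered_1
      by auto
    then have "unit_covered (Suc k) (cyc_prod u v)"
      unfolding cyc_prod_def
      by (induction rule: cyc_red_induct) (auto intro: unit_covered_cancel unit_covered_rotate)
    with prod(5) show ?thesis using unit_covered_cyclic_conjugate by blast
  qed
qed simp

text \<open>Let \<open>e\<close> be the longest overlap that cancels between the start of
  \<open>u\<close> and the end of \<open>v\<close>. Rotating both words by \<open>e\<close> moves
  this cancellation to the junction. By maximality either one rotated word is absorbed there or
  nothing cancels at the outer ends, which is the side condition of \<open>C_set\<close>.\<close>

lemma merge_C_set:
  assumes mem: "u \<in> C_set R k \<and> v \<in> C_set R 1 \<or> u \<in> C_set R 1 \<and> v \<in> C_set R k"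
    and touch: "last u = inv_letter (hd v)"
  shows "cl u + cl v = 0 \<or> crep R (Suc k) (3 ^ Suc k) (cl u + cl v)"
proof -
  have k: "k \<ge> 1" using mem C_set_pos by blast
  obtain e u2 v2 where ev: "u = e @ u2" "inv_word v = e @ v2"
      "u2 \<noteq> [] \<and> v2 \<noteq> [] \<longrightarrow> hd u2 \<noteq> hd v2"
    using common_prefix_ex by blast
  define v3 where "v3 = inv_word v2"
  have v: "v = v3 @ inv_word e" and v2: "v2 = inv_word v3"
    using arg_cong[OF ev(2), of inv_word] by (simp_all add: v3_def)
  define u' v' where "u' = u2 @ e" and "v' = inv_word e @ v3"
  have mem': "u' \<in> C_set R k \<and> v' \<in> C_set R 1 \<or> u' \<in> C_set R 1 \<and> v' \<in> C_set R k"
    using mem C_set_rotate unfolding u'_def v'_def ev(1) v by blast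
  have nonempty: "u \<noteq> []" "v \<noteq> []" using mem C_set_neq_Nil by blast+
  have eq: "cl u + cl v = cl e + (cl u' + cl v') + - cl e"
    unfolding u'_def v'_def ev(1) v by (simp only: fg_simps)
  have cond: "prefix (inv_word u') v' \<or> suffix (inv_word v') u' \<or>
      last u' = inv_letter (hd v') \<and> hd u' \<noteq> inv_letter (last v')"
  proof -
    consider "u2 = []" | "v3 = []" | "u2 \<noteq> []" "v3 \<noteq> []" by blast
    then show ?thesis
    proof cases
      case 3
      with ev(3) v2 have "hd u2 \<noteq> inv_letter (last v3)" by (simp add: hd_inv_word)
      moreover have "last u' = inv_letter (hd v')"
      proof (cases "e = []")
        case True
        with touch ev(1) v show ?thesis by (simp add: u'_def v'_def)
      qed (use 3 in \<open>simp add: u'_def v'_def hd_inv_word\<close>)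
      ultimately show ?thesis using 3 by (simp add: u'_def v'_def)
    qed (simp_all add: u'_def v'_def suffix_def)
  qed
  show ?thesis
  proof (cases "u' = inv_word v'")
    case True
    then have "cl u + cl v = 0" unfolding eq True by (simp only: fg_simps)
    then show ?thesis ..
  next
    case False
    have "cyc_prod u' v' \<in> C_set R (Suc k)"
      unfolding C_set_Suc[OF k] using mem' cond False
      by (intro CollectI exI[of _ u'] exI[of _ v']) auto
    moreover obtain t where "cl (u' @ v') = t + cl (cyc_prod u' v') + - t"
      using cl_cyc_red unfolding cyc_prod_def by blast
    ultimately have "crep R (Suc k) (3 ^ Suc k) (cl u' + cl v')"
      using crep_conj[OF crep_C_set] by (metis cl_append)
    then show ?thesis unfolding eq using crep_conj by blast
  qed
qed

text \<open>The word with the smaller index is broken up at the letter of contact. Merging its unit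
  with the other word keeps the index sum and raises the weight; if the two cancel, the index sum
  drops.\<close>

lemma touch_better:
  assumes c: "c \<in> C_set R k" and d: "d \<in> C_set R l" and touch: "last c = inv_letter (hd d)"
  shows "\<exists>N W. crep R N W (cl c + cl d) \<and> better (N, W) (k + l, 3 ^ k + 3 ^ l)"
proof -
  \<comment> \<open>\<open>g1\<close> is the merged factor, \<open>g2\<close> the product of the
    \<open>n - 1\<close> units left over from the word of smaller index \<open>n\<close>.\<close>
  have improve: "\<exists>N W. crep R N W g \<and> better (N, W) (m + n, 3 ^ m + 3 ^ n)"
    if g: "g = g1 + g2" "g1 = 0 \<or> crep R (Suc m) (3 ^ Suc m) g1" "crep R (n - 1) (3 * (n - 1)) g2"
      and nm: "n \<le> m" "1 \<le> n" for g g1 g2 n m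
    using g(2)
  proof
    assume "g1 = 0"
    with g nm show ?thesis by (intro exI[of _ "n - 1"] exI[of _ "3 * (n - 1)"]) (auto simp: better_def)
  next
    assume "crep R (Suc m) (3 ^ Suc m) g1"
    then have rep: "crep R (Suc m + (n - 1)) (3 ^ Suc m + 3 * (n - 1)) g"
      unfolding g(1) using g(3) by (rule crep_add)
    have "(3::nat) ^ n \<le> 3 ^ m" using nm by (simp add: power_increasing)
    moreover have "(3::nat) ^ m > 0" by simp
    ultimately have "3 ^ m + 3 ^ n < (3::nat) ^ Suc m + 3 * (n - 1)" unfolding power_Suc by linarith
    with rep show ?thesis using nm
      by (intro exI[of _ "Suc m + (n - 1)"] exI[of _ "3 ^ Suc m + 3 * (n - 1)"]) (auto simp: better_def)
  qed
  show ?thesis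
  proof (cases "l \<le> k")
    case True
    obtain b d' where d': "d = [] @ b # d'" using C_set_neq_Nil[OF d] by (cases d) auto
    obtain s where s: "b # s \<in> C_set R 1" "crep R (l - 1) (3 * (l - 1)) (- cl s + cl d' + cl [])"
      using unit_covered_C_set[OF d] d' unfolding unit_covered_def by blast
    show ?thesis
    proof (rule improve)
      show "cl c + cl d = (cl c + cl (b # s)) + (- cl s + cl d' + cl [])"
        unfolding d' by (simp only: fg_simps)
      show "cl c + cl (b # s) = 0 \<or> crep R (Suc k) (3 ^ Suc k) (cl c + cl (b # s))"
        using touch d' s(1) c by (intro merge_C_set) auto
    qed (use s True C_set_pos[OF d] in auto)
  next
    case False
    obtain b c' where c': "c = c' @ b # []" using C_set_neq_Nil[OF c] by (metis rev_exhaust)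
    obtain s where s: "b # s \<in> C_set R 1" "crep R (k - 1) (3 * (k - 1)) (- cl s + cl [] + cl c')"
      using unit_covered_C_set[OF c] c' unfolding unit_covered_def by blast
    \<comment> \<open>To be glued to \<open>d\<close>, the unit has to end with the letter of
      contact, the last letter \<open>b\<close> of \<open>c\<close>.\<close>
    have s': "s @ [b] \<in> C_set R 1" using s(1) C_set_rotate[of "[b]" s R 1] by simp
    have "\<exists>N W. crep R N W ((cl (s @ [b]) + cl d) + (cl c' + - cl s)) \<and> better (N, W) (l + k, 3 ^ l + 3 ^ k)"
    proof (rule improve[OF refl])
      show "cl (s @ [b]) + cl d = 0 \<or> crep R (Suc l) (3 ^ Suc l) (cl (s @ [b]) + cl d)"
        using touch c' s' d by (intro merge_C_set) auto
      show "crep R (k - 1) (3 * (k - 1)) (cl c' + - cl s)"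
        using crep_rotate[of R "k - 1" "3 * (k - 1)" "- cl s" "cl c'"] s(2) by (simp only: fg_simps)
    qed (use False C_set_pos[OF c] in auto)
    then obtain N W where "crep R N W ((cl c' + - cl s) + (cl (s @ [b]) + cl d))"
        "better (N, W) (l + k, 3 ^ l + 3 ^ k)"
      using crep_rotate by blast
    moreover have "(cl c' + - cl s) + (cl (s @ [b]) + cl d) = cl c + cl d"
      unfolding c' by (simp only: fg_simps)
    moreover have "l + k = k + l" "3 ^ l + 3 ^ k = 3 ^ k + (3 ^ l :: nat)" by simp_all
    ultimately show ?thesis by metis
  qed
qed

section \<open>Tracing the letters of a relator\<close>

text \<open>In the next two definitions \<open>b # y\<close> is a rotation of the relator under consideration.  The
  components \<open>N\<close> and \<open>W\<close> have to be distributed over the parts without loss, because the parts are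
  later reassembled into a better product.\<close>

definition edge_on_corolla :: "nat \<Rightarrow> nat \<Rightarrow> 'a \<times> bool \<Rightarrow> 'a word \<Rightarrow> bool" where
  "edge_on_corolla N W b y \<longleftrightarrow>
     (\<exists>k N' W' c. b # c \<in> C_set R k \<and> N = N' + k \<and> W = W' + 3 ^ k \<and> crep R N' W' (- cl c + cl y))"

definition edge_is_bridge :: "nat \<Rightarrow> nat \<Rightarrow> 'a \<times> bool \<Rightarrow> 'a word \<Rightarrow> bool" where
  "edge_is_bridge N W b y \<longleftrightarrow>
     (\<exists>y1 y2 N1 W1 N2 W2. y = y1 @ inv_letter b # y2 \<and> N = N1 + N2 \<and> W = W1 + W2 \<and>
        crep R N1 W1 (cl y1) \<and> crep R N2 W2 (cl y2))"

text \<open>Only \<open>N\<close> and \<open>W\<close> are common to all letters; each letter may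
  have its own product.\<close>

definition traced :: "nat \<Rightarrow> nat \<Rightarrow> 'a word \<Rightarrow> bool" where
  "traced N W w \<longleftrightarrow>
     (\<forall>p b q. w = p @ b # q \<longrightarrow> edge_on_corolla N W b (q @ p) \<or> edge_is_bridge N W b (q @ p))"

lemma tracedD:
  assumes "traced N W w" "w = p @ b # q"
  obtains (corolla) k N' W' c where "b # c \<in> C_set R k" "N = N' + k" "W = W' + 3 ^ k"
      "crep R N' W' (- cl c + cl q + cl p)"
  | (bridge) y1 y2 N1 W1 N2 W2 where "q @ p = y1 @ inv_letter b # y2" "N = N1 + N2" "W = W1 + W2"
      "crep R N1 W1 (cl y1)" "crep R N2 W2 (cl y2)"
proof -
  from assms consider "edge_on_corolla N W b (q @ p)" | "edge_is_bridge N W b (q @ p)"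
    unfolding traced_def by blast
  then show ?thesis
  proof cases
    case 1
    then show ?thesis unfolding edge_on_corolla_def using corolla by (auto simp: cl_append add.assoc)
  next
    case 2
    then show ?thesis unfolding edge_is_bridge_def using bridge by blast
  qed
qed

lemma edge_on_corollaI:
  "b # c \<in> C_set R k \<Longrightarrow> N = N' + k \<Longrightarrow> W = W' + 3 ^ k \<Longrightarrow> crep R N' W' g \<Longrightarrow>
    g = - cl c + cl y \<Longrightarrow> edge_on_corolla N W b y"
  unfolding edge_on_corolla_def by blast

lemma edge_is_bridgeI:
  "y = y1 @ inv_letter b # y2 \<Longrightarrow> N = N1 + N2 \<Longrightarrow> W = W1 + W2 \<Longrightarrow> crep R N1 W1 g1 \<Longrightarrow>
    crep R N2 W2 g2 \<Longrightarrow> g1 = cl y1 \<Longrightarrow> g2 = cl y2 \<Longrightarrow> edge_is_bridge N W b y"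
  unfolding edge_is_bridge_def by blast

text \<open>Letters of \<open>c1\<close> lie on the new factor. Letters of \<open>v1\<close> keep
  their role, with the new factor added to the remainder or to one part, unless a bridge has its
  partner in the cancelled \<open>inv_word z\<close>: then \<open>b\<close> occurs in
  \<open>z\<close> and is placed on the new factor.\<close>

lemma traced_mult:
  assumes c: "c1 @ z \<in> C_set R k" and rep: "crep R N W (cl (inv_word z @ v1))"
    and tr: "traced N W (inv_word z @ v1)"
  shows "traced (N + k) (W + 3 ^ k) (c1 @ v1)"
  unfolding traced_def
proof (intro allI impI)
  fix p b q assume "c1 @ v1 = p @ b # q"
  then show "edge_on_corolla (N + k) (W + 3 ^ k) b (q @ p) \<or> edge_is_bridge (N + k) (W + 3 ^ k) b (q @ p)"
  proof (cases rule: append_eq_append_Cons_cases)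
    case (1 r)
    have "b # r @ z @ p \<in> C_set R k" using c 1 C_set_rotate[of p "b # r @ z" R k] by simp
    then have "edge_on_corolla (N + k) (W + 3 ^ k) b (q @ p)"
      by (rule edge_on_corollaI[OF _ refl refl crep_conj[OF rep, of "- cl p"]])
        (simp only: 1 fg_simps)
    then show ?thesis ..
  next
    case (2 p')
    have c': "crep R k (3 ^ k) (cl (c1 @ z))" using c by (rule crep_C_set)
    from 2 have "inv_word z @ v1 = (inv_word z @ p') @ b # q" by simp
    from tr this show ?thesis
    proof (cases rule: tracedD)
      case (corolla l N' W' d)
      have "crep R (N' + k) (W' + 3 ^ k) ((- cl d + cl q) + (cl (c1 @ z) + cl (inv_word z @ p')))"
        using crep_insert[OF corolla(4) c'] .
      then have "edge_on_corolla (N + k) (W + 3 ^ k) b (q @ p)"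
        using corolla by (elim edge_on_corollaI[OF corolla(1), rotated 2]) (simp_all only: 2 fg_simps ac_simps)
      then show ?thesis ..
    next
      case (bridge y1 y2 N1 W1 N2 W2)
      from bridge(1) show ?thesis
      proof (cases rule: append_eq_append_Cons_cases)
        case q: (1 r)
        have "crep R N2 W2 (cl r + cl (inv_word z @ p'))" using bridge(5) q by (simp only: cl_append)
        from crep_insert[OF this c']
        have h: "crep R (N2 + k) (W2 + 3 ^ k) (cl r + (cl (c1 @ z) + cl (inv_word z @ p')))" .
        have "edge_is_bridge (N + k) (W + 3 ^ k) b (q @ p)"
          by (rule edge_is_bridgeI[OF _ _ _ bridge(4) h, where ?y2.0 = "r @ p"])
            (simp_all only: q 2 bridge fg_simps ac_simps)
        then show ?thesis ..
      next
        case p: (2 r)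
        from p(2) show ?thesis
        proof (cases rule: append_eq_append_Cons_cases)
          case z: (1 t)
          have z': "z = inv_word t @ b # inv_word r"
            using arg_cong[OF z(1), of inv_word] by simp
          have mem: "b # inv_word r @ c1 @ inv_word t \<in> C_set R k"
            using c C_set_rotate[of "c1 @ inv_word t" "b # inv_word r" R k] by (simp add: z')
          have "crep R N1 W1 (cl r + cl q)"
            using bridge(4) p crep_rotate[of R N1 W1 "cl q" "cl r"] by (simp add: cl_append)
          from crep_insert[OF _ crep_conj[OF this, of "- cl c1"], of N2 W2 "cl t" "cl p'"]
          have rep': "crep R N W (cl t + (- cl c1 + (cl r + cl q) + - (- cl c1) + cl p'))"
            using bridge z by (simp add: cl_append ac_simps)
          have "edge_on_corolla (N + k) (W + 3 ^ k) b (q @ p)"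
            by (rule edge_on_corollaI[OF mem refl refl rep']) (simp only: 2 fg_simps)
          then show ?thesis ..
        next
          case pp: (2 t)
          have "crep R N1 W1 (cl q + cl (inv_word z @ t))" using bridge(4) p pp by (simp only: cl_append)
          from crep_insert[OF this c']
          have h: "crep R (N1 + k) (W1 + 3 ^ k) (cl q + (cl (c1 @ z) + cl (inv_word z @ t)))" .
          have "edge_is_bridge (N + k) (W + 3 ^ k) b (q @ p)"
            by (rule edge_is_bridgeI[OF _ _ _ h bridge(5), where ?y1.0 = "q @ c1 @ t"])
              (simp_all only: p pp 2 bridge fg_simps ac_simps)
          then show ?thesis ..
        qed
      qed
    qed
  qed
qed

lemma traced_rotate:
  assumes "traced N W (u @ v)"
  shows "traced N W (v @ u)"
  unfolding traced_def
proof (intro allI impI)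
  fix p b q assume "v @ u = p @ b # q"
  then obtain p' q' where "u @ v = p' @ b # q'" "q' @ p' = q @ p"
    by (cases rule: append_eq_append_Cons_cases) (metis append.assoc append_Cons)+
  with assms show "edge_on_corolla N W b (q @ p) \<or> edge_is_bridge N W b (q @ p)"
    unfolding traced_def by metis
qed

text \<open>The word is a rotation of the conjugate of \<open>v\<close> by \<open>a\<close>. The two
  new letters form a bridge with the whole product on one side; elsewhere they are a cancelling pair
  that changes no group element.\<close>

lemma traced_add_conj:
  assumes rep: "crep R N W (cl v)" and tr: "traced N W v"
  shows "traced N W (v @ [inv_letter a, a])"
  unfolding traced_def
proof (intro allI impI)
  fix p b q assume "v @ [inv_letter a, a] = p @ b # q"
  then show "edge_on_corolla N W b (q @ p) \<or> edge_is_bridge N W b (q @ p)"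
  proof (cases rule: append_eq_append_Cons_cases)
    case (1 r)
    from tr 1(1) show ?thesis
    proof (cases rule: tracedD)
      case (corolla l N' W' d)
      then have "edge_on_corolla N W b (q @ p)"
        by (elim edge_on_corollaI) (simp_all only: 1 fg_simps)
      then show ?thesis ..
    next
      case (bridge y1 y2 N1 W1 N2 W2)
      from bridge(1) show ?thesis
      proof (cases rule: append_eq_append_Cons_cases)
        case r: (1 s)
        have "edge_is_bridge N W b (q @ p)"
          by (rule edge_is_bridgeI[OF _ bridge(2-5), where ?y2.0 = "s @ [inv_letter a, a] @ p"])
            (simp_all only: 1 r fg_simps)
        then show ?thesis ..
      next
        case r: (2 s)
        have "edge_is_bridge N W b (q @ p)"
          by (rule edge_is_bridgeI[OF _ bridge(2-5), where ?y1.0 = "r @ [inv_letter a, a] @ s"])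
            (simp_all only: 1 r fg_simps)
        then show ?thesis ..
      qed
    qed
  next
    case (2 r)
    then consider "p = v" "b = inv_letter a" "q = [a]" | "p = v @ [inv_letter a]" "b = a" "q = []"
      by (auto simp: Cons_eq_append_conv)
    then show ?thesis
    proof cases
      case 1
      then have "edge_is_bridge N W b (q @ p)"
        by (intro edge_is_bridgeI[OF _ _ _ crep.zero rep, of _ "[]" _ v]) (simp_all add: cl_Nil)
      then show ?thesis ..
    next
      case 2
      then have "edge_is_bridge N W b (q @ p)"
        by (intro edge_is_bridgeI[OF _ _ _ rep crep.zero, of _ v _ "[]"]) (simp_all add: cl_Nil)
      then show ?thesis ..
    qed
  qed
qed

text \<open>If the partner of \<open>b\<close> is one of the removed letters, a new partner is found by tracing the other
  removed letter in the part that contains it; that part uses fewer factors.\<close>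

lemma traced_remove_conj:
  assumes red: "reduced ([a] @ v @ [inv_letter a])" and tr: "traced N W ([a] @ v @ [inv_letter a])"
    and IH: "\<And>N' W' u. N' < N \<Longrightarrow> crep R N' W' (cl u) \<Longrightarrow> reduced u \<Longrightarrow> traced N' W' u"
  shows "traced N W v"
  unfolding traced_def
proof (intro allI impI)
  fix p b q assume v: "v = p @ b # q"
  \<comment> \<open>If one side of a bridge is a non-empty reduced word, its index sum is positive;
    the other side then has index sum below \<open>N\<close>, so that \<open>IH\<close> applies to
    it.\<close>
  have pos: "N' > 0" if "crep R N' W' (cl u)" "reduced u" "u \<noteq> []" for N' W' u
    using crep_eq_0[OF that(1)] that(2,3) by (auto simp: cl_eq_0_iff red_reduced)
  have red_parts: "reduced (a # p)" "reduced p" "reduced q" "reduced (q @ [inv_letter a])"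
    "reduced (p @ [b])" "reduced (a # p @ [b])" "reduced (b # q @ [inv_letter a])"
    using red unfolding v by (auto simp: reduced_Cons reduced_append hd_append split: if_splits)
  have "[a] @ v @ [inv_letter a] = ([a] @ p) @ b # (q @ [inv_letter a])" using v by simp
  from tr this show "edge_on_corolla N W b (q @ p) \<or> edge_is_bridge N W b (q @ p)"
  proof (cases rule: tracedD)
    case (corolla l N' W' d)
    then have "edge_on_corolla N W b (q @ p)"
      by (elim edge_on_corollaI) (simp_all only: fg_simps)
    then show ?thesis ..
  next
    case (bridge y1 y2 N1 W1 N2 W2)
    from bridge(1) have "q @ (inv_letter a # a # p) = y1 @ inv_letter b # y2" by simp
    then show ?thesis
    proof (cases rule: append_eq_append_Cons_cases)
      case q: (1 s)
      have "edge_is_bridge N W b (q @ p)"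
        by (rule edge_is_bridgeI[OF _ bridge(2-5), where ?y2.0 = "s @ p"])
          (simp_all only: q fg_simps)
      then show ?thesis ..
    next
      case (2 s)
      then consider (outer) "s = []" "b = a" "y2 = a # p"
        | (inner) "s = [inv_letter a]" "b = inv_letter a" "y2 = p"
        | (far) t where "s = inv_letter a # a # t" "p = t @ inv_letter b # y2"
        by (auto simp: Cons_eq_append_conv)
      then show ?thesis
      proof cases
        case far
        have "edge_is_bridge N W b (q @ p)"
          by (rule edge_is_bridgeI[OF _ bridge(2-5), where ?y1.0 = "q @ t"])
            (simp_all only: far 2 fg_simps)
        then show ?thesis ..
      next
        \<comment> \<open>The partner of \<open>b\<close> is the closing letter. The opening letter
          \<open>a\<close>, traced in \<open>a # p\<close>, equals \<open>b\<close> and hands its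
          role to \<open>b\<close> once the product for \<open>q\<close> is added.\<close>
        case outer
        have y1: "y1 = q" using 2 outer by simp
        have "q \<noteq> []" using red_parts(7) outer by (auto simp: reduced_Cons)
        then have "N1 > 0" using pos bridge(4) red_parts y1 by blast
        then have tr': "traced N2 W2 (a # p)"
          using IH bridge red_parts outer by auto
        have "a # p = [] @ b # p" using outer by simp
        from tr' this show ?thesis
        proof (cases rule: tracedD)
          case (corolla l N' W' d)
          have "crep R N' W' (- cl d + cl p)" using corolla(4) by (simp add: cl_Nil)
          from crep_insert[OF this bridge(4)] have "edge_on_corolla N W b (q @ p)"
            by (rule edge_on_corollaI[OF corolla(1), rotated 2]) (simp_all add: bridge corolla y1 cl_append add.assoc)
          then show ?thesis ..
        next
          case b2: (bridge z1 z2 N3 W3 N4 W4)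
          have "edge_is_bridge N W b (q @ p)"
            by (rule edge_is_bridgeI[OF _ _ _ crep_add[OF bridge(4) b2(4)] b2(5), where ?y1.0="q @ z1" and ?y2.0 = z2])
              (use b2 bridge y1 in \<open>simp_all add: cl_append\<close>)
          then show ?thesis ..
        qed
      next
        \<comment> \<open>The mirror case: the partner of \<open>b\<close> is the opening letter,
          and the closing letter is traced instead.\<close>
        case inner
        have y1: "y1 = q @ [inv_letter a]" using 2 inner by simp
        have "p \<noteq> []" using red_parts(6) inner by (auto simp: reduced_Cons)
        then have "N2 > 0" using pos bridge(5) red_parts inner by blast
        then have tr': "traced N1 W1 (q @ [inv_letter a])"
          using IH bridge red_parts y1 by auto
        have "q @ [inv_letter a] = q @ b # []" using inner by simp
        from tr' this show ?thesis
        proof (cases rule: tracedD)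
          case (corolla l N' W' d)
          have "crep R N' W' (- cl d + cl q)" using corolla(4) by (simp add: cl_Nil)
          from crep_add[OF this bridge(5)] have "edge_on_corolla N W b (q @ p)"
            by (rule edge_on_corollaI[OF corolla(1), rotated 2]) (simp_all add: bridge corolla inner cl_append add.assoc)
          then show ?thesis ..
        next
          case b2: (bridge z1 z2 N3 W3 N4 W4)
          have "edge_is_bridge N W b (q @ p)"
            by (rule edge_is_bridgeI[OF _ _ _ b2(4) crep_add[OF b2(5) bridge(5)], where ?y1.0=z1 and ?y2.0 = "z2 @ p"])
              (use b2 bridge inner in \<open>simp_all add: cl_append flip: append_assoc\<close>)
          then show ?thesis ..
        qed
      qed
    qed
  qed
qed

text \<open>If both ends of \<open>v\<close> cancel against the conjugating letters, a pair is
  removed; if one end does, the result is a rotation; if neither does, a pair is added, up to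
  rotation.\<close>

lemma traced_conj_letter:
  assumes rep: "crep R N W (cl v)" and red: "reduced v" and tr: "traced N W v"
    and IH: "\<And>N' W' u. N' < N \<Longrightarrow> crep R N' W' (cl u) \<Longrightarrow> reduced u \<Longrightarrow> traced N' W' u"
  shows "traced N W (red (a # v @ [inv_letter a]))"
proof (cases "v = []")
  case True
  have "red [a, inv_letter a] = []" by (simp add: red_def)
  with True show ?thesis by (simp add: traced_def)
next
  case False
  have eq: "red (a # v @ [inv_letter a]) = w" if "reduced w" "cl w = lt a + cl v + - lt a" for w
    using that cl_eq_reduced[OF _ reduced_red that(1), of "a # v @ [inv_letter a]"] by (simp only: cl_red fg_simps)
  show ?thesis
  proof (cases "hd v = inv_letter a")
    case h: True
    then obtain v' where v: "v = inv_letter a # v'" using False by (cases v) auto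
    show ?thesis
    proof (cases "v' \<noteq> [] \<and> last v' = a")
      case True
      then obtain v'' where "v' = v'' @ [a]" by (metis append_butlast_last_id)
      with v have v'': "v = [inv_letter a] @ v'' @ [inv_letter (inv_letter a)]" by simp
      then have "reduced v''" using red by (auto simp: reduced_append reduced_Cons)
      then have "red (a # v @ [inv_letter a]) = v''" by (rule eq) (simp only: v'' fg_simps)
      then show ?thesis using traced_remove_conj[of "inv_letter a" v''] red tr IH v'' by auto
    next
      case l: False
      have "reduced (v' @ [inv_letter a])" using red l by (auto simp: v reduced_append reduced_Cons)
      then have "red (a # v @ [inv_letter a]) = v' @ [inv_letter a]" by (rule eq) (simp only: v fg_simps)
      then show ?thesis using traced_rotate[of N W "[inv_letter a]" v'] tr v by auto
    qed
  next
    case h: False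
    show ?thesis
    proof (cases "last v = a")
      case True
      then obtain v' where v: "v = v' @ [a]" using False by (metis append_butlast_last_id)
      have "reduced (a # v')" using red h by (auto simp: v reduced_append reduced_Cons split: if_splits)
      then have "red (a # v @ [inv_letter a]) = a # v'" by (rule eq) (simp only: v fg_simps)
      then show ?thesis using traced_rotate[of N W v' "[a]"] tr v by auto
    next
      case l: False
      have "reduced (a # v @ [inv_letter a])" using red h l False by (auto simp: reduced_append reduced_Cons)
      then have "red (a # v @ [inv_letter a]) = [a] @ v @ [inv_letter a]" by (simp add: red_reduced)
      then show ?thesis
        using traced_rotate[of N W "v @ [inv_letter a]" "[a]"] traced_add_conj[OF rep tr, of a] by simp
    qed
  qed
qed

lemma traced_conj:
  assumes rep: "crep R N W (cl v)" and red: "reduced v" and tr: "traced N W v"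
    and IH: "\<And>N' W' u. N' < N \<Longrightarrow> crep R N' W' (cl u) \<Longrightarrow> reduced u \<Longrightarrow> traced N' W' u"
  shows "traced N W (red (x @ v @ inv_word x))"
proof (induction x)
  case Nil
  with red tr show ?case by (simp add: red_reduced)
next
  case (Cons a x)
  let ?u = "red (x @ v @ inv_word x)"
  have "crep R N W (cl ?u)" using crep_conj[OF rep, of "cl x"] by (simp only: cl_red fg_simps)
  from traced_conj_letter[OF this reduced_red Cons IH, of a]
  have "traced N W (red (a # ?u @ [inv_letter a]))" .
  moreover have "red (a # ?u @ [inv_letter a]) = red ((a # x) @ v @ inv_word (a # x))"
    by (rule cl_eq_reduced) (simp_all only: cl_red fg_simps reduced_red)
  ultimately show ?case by simp
qed

text \<open>Split off the first factor: \<open>w\<close> is the conjugate by \<open>x\<close> of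
  \<open>cl c + cl v\<close>, where \<open>v\<close> has a smaller index sum. Once the maximal
  cancellation \<open>z\<close> between \<open>c\<close> and \<open>v\<close> is removed,
  \<open>traced_mult\<close> applies; the conjugation by \<open>x\<close> is then carried out letter
  by letter.\<close>

lemma traced_reduced:
  "crep R N W (cl w) \<Longrightarrow> reduced w \<Longrightarrow> traced N W w"
proof (induction N arbitrary: W w rule: less_induct)
  case (less N)
  from less.prems(1) show ?case
  proof (cases rule: crep.cases)
    case zero
    then have "w = []" using less.prems by (simp add: cl_eq_0_iff red_reduced)
    then show ?thesis by (simp add: traced_def)
  next
    case (step N' W' g c k x)
    define v where "v = rep_fg (- x + g + x)"
    have v: "cl v = - x + g + x" "reduced v"
      using rep_fg by (auto simp: v_def cl_rep)
    have rv: "crep R N' W' (cl v)" using crep_conj[OF step(4), of "- x"] by (simp add: v)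
    have "N' < N" using step C_set_pos by fastforce
    with less.IH rv v have tv: "traced N' W' v" by blast
    obtain z c1 v1' where z: "c = c1 @ z" "inv_word v = v1' @ z"
        "c1 \<noteq> [] \<and> v1' \<noteq> [] \<longrightarrow> last c1 \<noteq> last v1'"
      using common_suffix_ex by blast
    have v': "v = inv_word z @ inv_word v1'" using arg_cong[OF z(2), of inv_word] by simp
    have tr: "traced N W (c1 @ inv_word v1')"
      using traced_mult[of c1 z k N' W' "inv_word v1'"] step z rv tv v' by simp
    have red: "reduced (c1 @ inv_word v1')"
      using C_set_reduced[OF step(5)] v z v' by (auto simp: reduced_append hd_inv_word)
    have eq: "cl (c1 @ inv_word v1') = cl c + cl v" unfolding z v' by (simp only: fg_simps)
    have rep: "crep R N W (cl (c1 @ inv_word v1'))"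
      unfolding eq using crep_add[OF crep_C_set[OF step(5)] rv] step by (simp add: ac_simps)
    from traced_conj[OF rep red tr less.IH, of "rep_fg x"]
    have "traced N W (red (rep_fg x @ (c1 @ inv_word v1') @ inv_word (rep_fg x)))" .
    moreover have "red (rep_fg x @ (c1 @ inv_word v1') @ inv_word (rep_fg x)) = w"
    proof (rule cl_eq_reduced)
      have "cl (rep_fg x @ (c1 @ inv_word v1') @ inv_word (rep_fg x)) = x + (cl c + cl v) + - x"
        unfolding eq[symmetric] by (simp add: cl_append cl_inv_word cl_rep add.assoc del: add_uminus_conv_diff)
      also have "\<dots> = cl w" unfolding v step(3) by (simp only: fg_simps)
      finally show "cl (red (rep_fg x @ (c1 @ inv_word v1') @ inv_word (rep_fg x))) = cl w" by simp
    qed (use less.prems reduced_red in auto)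
    ultimately show ?thesis by simp
  qed
qed

end

section \<open>Simple relators\<close>

lemma crep_optimal_ex:
  assumes "crep R N W g"
  shows "\<exists>N W. crep R N W g \<and> (\<forall>N' W'. crep R N' W' g \<longrightarrow> \<not> better (N', W') (N, W))"
proof -
  define n where "n = (LEAST n. \<exists>W. crep R n W g)"
  have n: "\<exists>W. crep R n W g"
    unfolding n_def by (rule LeastI_ex) (use assms in blast)
  have n_le: "n \<le> N" if "crep R N W g" for N W
    unfolding n_def by (rule Least_le) (use that in blast)
  have "finite {W. crep R n W g}"
    by (rule finite_subset[of _ "{..3 ^ n}"]) (auto dest: crep_weight_le)
  then have "crep R n (Max {W. crep R n W g}) g" "\<And>W. crep R n W g \<Longrightarrow> W \<le> Max {W. crep R n W g}"
    using n Max_in[of "{W. crep R n W g}"] by auto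
  moreover have "\<not> better (N', W') (n, Max {W. crep R n W g})" if "crep R N' W' g" for N' W'
    using calculation(2) n_le[OF that] that by (auto simp: better_def not_less)
  ultimately show ?thesis by blast
qed

context word_presentation
begin

text \<open>The factor \<open>\<alpha> @ inv_word \<sigma>\<close> times \<open>cl \<sigma>\<close>
  is \<open>cl \<alpha>\<close>, and the factor ends with the inverse of the first letter of
  \<open>\<sigma>\<close>. Either a gluing takes place there, or this letter is a bridge and a
  shorter relator inside \<open>\<sigma>\<close> takes over.\<close>

lemma better_of_subrelator:
  assumes "\<alpha> @ inv_word \<sigma> \<in> C_set R k" "\<sigma> \<noteq> []" "crep R N W (cl \<sigma>)"
  shows "\<exists>N' W'. crep R N' W' (cl \<alpha>) \<and> better (N', W') (k + N, 3 ^ k + W)"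
  using assms
proof (induction "length \<sigma>" arbitrary: \<alpha> \<sigma> N W rule: less_induct)
  case less
  have red: "reduced \<sigma>"
    using C_set_reduced[OF less.prems(1)] reduced_inv_word[of "inv_word \<sigma>"] by (auto simp: reduced_append)
  obtain b \<sigma>' where \<sigma>: "\<sigma> = [] @ b # \<sigma>'" using less.prems(2) by (cases \<sigma>) auto
  from traced_reduced[OF less.prems(3) red] \<sigma> show ?case
  proof (cases rule: tracedD)
    case (corolla l N' W' d)
    let ?c = "\<alpha> @ inv_word \<sigma>"
    obtain N1 W1 where 1: "crep R N1 W1 (cl ?c + cl (b # d))" "better (N1, W1) (k + l, 3 ^ k + 3 ^ l)"
      using touch_better[OF less.prems(1) corolla(1)] \<sigma> by auto
    have "crep R (N1 + N') (W1 + W') (cl ?c + cl (b # d) + (- cl d + cl \<sigma>' + cl []))"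
      using crep_add[OF 1(1) corolla(4)] .
    also have "cl ?c + cl (b # d) + (- cl d + cl \<sigma>' + cl []) = cl \<alpha>"
      unfolding \<sigma> by (simp only: fg_simps)
    finally have "crep R (N1 + N') (W1 + W') (cl \<alpha>)" .
    moreover have "better (N1 + N', W1 + W') (k + N, 3 ^ k + W)"
      using better_add[OF 1(2), of N' W'] corolla by (simp add: ac_simps)
    ultimately show ?thesis by blast
  next
    case (bridge s1 s2 N1 W1 N2 W2)
    then have \<sigma>': "\<sigma> = b # s1 @ inv_letter b # s2" using \<sigma> by simp
    \<comment> \<open>A rotation of the factor is \<open>?\<beta> @ inv_word s1\<close>. Conjugating
      \<open>?\<beta>\<close> by \<open>b\<close> and multiplying by \<open>s2\<close> on the right
      gives back \<open>\<alpha>\<close>.\<close>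
    let ?\<beta> = "inv_letter b # \<alpha> @ inv_word s2 @ [b]"
    have "s1 \<noteq> []" using red \<sigma>' by (auto simp: reduced_Cons)
    moreover have "?\<beta> @ inv_word s1 \<in> C_set R k"
      using less.prems(1) C_set_rotate[of "\<alpha> @ inv_word s2 @ [b] @ inv_word s1" "[inv_letter b]" R k]
      by (simp add: \<sigma>')
    ultimately obtain N' W' where 1: "crep R N' W' (cl ?\<beta>)" "better (N', W') (k + N1, 3 ^ k + W1)"
      using less.hyps[of s1 ?\<beta> N1 W1] bridge(4) \<sigma>' by auto
    have "crep R N' W' (lt b + cl ?\<beta> + - lt b)" using crep_conj[OF 1(1)] .
    from crep_add[OF this bridge(5)]
    have "crep R (N' + N2) (W' + W2) (lt b + cl ?\<beta> + - lt b + cl s2)" .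
    also have "lt b + cl ?\<beta> + - lt b + cl s2 = cl \<alpha>" by (simp only: fg_simps)
    finally have "crep R (N' + N2) (W' + W2) (cl \<alpha>)" .
    moreover have "better (N' + N2, W' + W2) (k + N, 3 ^ k + W)"
      using better_add[OF 1(2), of N2 W2] bridge by (simp add: ac_simps)
    ultimately show ?thesis by blast
  qed
qed

text \<open>Here \<open>z\<close> is a maximal stretch shared by the relator \<open>z @ w'\<close>
  and a factor \<open>z @ c'\<close>. If \<open>c'\<close> is empty, \<open>z\<close> is a relator
  and simplicity leaves no room for \<open>w'\<close>; every other case contradicts optimality,
  simplicity or maximality.\<close>

lemma optimal_rotation_in_C_set:
  assumes cred: "cyc_reduced (z @ w')" and z: "z \<noteq> []" and c: "z @ c' \<in> C_set R k"
    and hds: "w' \<noteq> [] \<and> c' \<noteq> [] \<longrightarrow> hd w' \<noteq> hd c'"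
    and lasts: "w' \<noteq> [] \<and> c' \<noteq> [] \<longrightarrow> last w' \<noteq> last c'"
    and rep: "crep R N W (cl (inv_word c' @ w'))"
    and opt: "\<And>N' W'. crep R N' W' (cl (z @ w')) \<Longrightarrow> \<not> better (N', W') (k + N, 3 ^ k + W)"
    and simple: "\<And>u v N W. cyclic_conjugate (u @ v) (z @ w') \<Longrightarrow> u \<noteq> [] \<Longrightarrow> v \<noteq> [] \<Longrightarrow>
      \<not> crep R N W (cl u)"
  shows "z @ w' \<in> C_set R k"
proof -
  let ?c = "z @ c'"
  have red_c: "reduced ?c" using C_set_reduced[OF c] .
  have red_w: "reduced (z @ w')" using cred by (simp add: cyc_reduced_def)
  consider "c' = []" | "c' \<noteq> []" "w' = []" | "c' \<noteq> []" "w' \<noteq> []" by blast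
  then show ?thesis
  proof cases
    case 1
    then have "crep R k (3 ^ k) (cl z)" using crep_C_set[OF c] by simp
    then have "w' = []" using simple[of z w'] z by auto
    with 1 c show ?thesis by simp
  next
    case 2
    have "\<exists>N' W'. crep R N' W' (cl z) \<and> better (N', W') (k + N, 3 ^ k + W)"
      using better_of_subrelator[of z "inv_word c'" k N W] 2 c rep by simp
    with opt 2 show ?thesis by auto
  next
    case 3
    define y where "y = inv_word c' @ w'"
    have red_y: "reduced y"
      using red_c red_w 3 hds by (auto simp: y_def reduced_append reduced_inv_word last_inv_word)
    \<comment> \<open>The complement \<open>y\<close> starts with the inverse \<open>b\<close> of
      the last letter of the factor, so a factor carrying \<open>b\<close> could be glued on
      there.\<close>
    obtain c2 b0 where c2: "c' = c2 @ [b0]" using 3 by (metis rev_exhaust)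
    define b where "b = inv_letter b0"
    have c'_eq: "c' = c2 @ [inv_letter b]" using c2 by (simp add: b_def)
    have y_eq: "y = [] @ b # (inv_word c2 @ w')" by (simp add: y_def c'_eq)
    have w_eq: "cl (z @ w') = cl ?c + cl y" unfolding y_def by (simp only: fg_simps)
    have False
      using traced_reduced[OF rep[folded y_def] red_y] y_eq
    proof (cases rule: tracedD)
      case (corolla l N' W' d)
      obtain N1 W1 where 1: "crep R N1 W1 (cl ?c + cl (b # d))" "better (N1, W1) (k + l, 3 ^ k + 3 ^ l)"
        using touch_better[OF c corolla(1)] c'_eq by auto
      have "crep R (N1 + N') (W1 + W') (cl ?c + cl (b # d) + (- cl d + cl (inv_word c2 @ w') + cl []))"
        using crep_add[OF 1(1) corolla(4)] .
      also have "cl ?c + cl (b # d) + (- cl d + cl (inv_word c2 @ w') + cl []) = cl (z @ w')"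
        unfolding w_eq y_eq by (simp only: fg_simps)
      finally have "crep R (N1 + N') (W1 + W') (cl (z @ w'))" .
      moreover have "better (N1 + N', W1 + W') (k + N, 3 ^ k + W)"
        using better_add[OF 1(2), of N' W'] corolla by (simp add: ac_simps)
      ultimately show False using opt by blast
    next
      case (bridge e1 e2 N1 W1 N2 W2)
      then have "inv_word c2 @ w' = e1 @ inv_letter b # e2" by simp
      then show False
      proof (cases rule: append_eq_append_Cons_cases)
        \<comment> \<open>The partner of \<open>b\<close> lies on the factor, so \<open>e1\<close>
          is a relator whose inverse is a subword of \<open>c'\<close>.\<close>
        case (1 f)
        have c2': "c2 = inv_word f @ b # inv_word e1"
          using arg_cong[OF 1(1), of inv_word] by simp
        let ?\<beta> = "inv_letter b # z @ inv_word f @ [b]"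
        have "e1 \<noteq> []" using red_c by (auto simp: c'_eq c2' reduced_append reduced_Cons)
        moreover have "?\<beta> @ inv_word e1 \<in> C_set R k"
          using c C_set_rotate[of "z @ inv_word f @ [b] @ inv_word e1" "[inv_letter b]" R k]
          by (simp add: c'_eq c2')
        ultimately obtain N' W' where 2: "crep R N' W' (cl ?\<beta>)" "better (N', W') (k + N1, 3 ^ k + W1)"
          using better_of_subrelator bridge(4) by blast
        have "crep R N' W' (lt b + cl ?\<beta> + - lt b)" using crep_conj[OF 2(1)] .
        from crep_add[OF this bridge(5)]
        have "crep R (N' + N2) (W' + W2) (lt b + cl ?\<beta> + - lt b + cl e2)" .
        also have "lt b + cl ?\<beta> + - lt b + cl e2 = cl (z @ w')" unfolding 1 by (simp only: fg_simps)
        finally have "crep R (N' + N2) (W' + W2) (cl (z @ w'))" .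
        moreover have "better (N' + N2, W' + W2) (k + N, 3 ^ k + W)"
          using better_add[OF 2(2), of N2 W2] bridge by (simp add: ac_simps)
        ultimately show False using opt by blast
      next
        \<comment> \<open>The partner lies on \<open>w'\<close>. Simplicity forces the relator
          \<open>e2\<close> to be empty, and then \<open>w'\<close> and \<open>c'\<close> end with
          the same letter, against \<open>lasts\<close>.\<close>
        case (2 g)
        show False
        proof (cases "e2 = []")
          case True
          with 2 lasts 3 c'_eq show False by simp
        next
          case False
          have "cyclic_conjugate (e2 @ (z @ g @ [inv_letter b])) ((z @ g @ [inv_letter b]) @ e2)"
            by (rule cyclic_conjugate_rotate)
          with simple[of e2 "z @ g @ [inv_letter b]"] False 2 z bridge(5) show False by simp
        qed
      qed
    qed
    then show ?thesis ..
  qed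
qed

text \<open>If the first letter were a bridge, it would cut off the proper subword \<open>y1\<close>
  as a relator; so it lies on a factor. The stretch shared with this factor is enlarged in both
  directions and a rotation starts with it.\<close>

theorem simple_relator_in_C_set:
  assumes cred: "cyc_reduced w" and ne: "w \<noteq> []" and rel: "\<exists>N W. crep R N W (cl w)"
    and simple: "\<And>u v N W. cyclic_conjugate (u @ v) w \<Longrightarrow> u \<noteq> [] \<Longrightarrow> v \<noteq> [] \<Longrightarrow>
      \<not> crep R N W (cl u)"
  shows "\<exists>k. w \<in> C_set R k"
proof -
  obtain N W where rep: "crep R N W (cl w)"
    and opt: "\<And>N' W'. crep R N' W' (cl w) \<Longrightarrow> \<not> better (N', W') (N, W)"
    using rel crep_optimal_ex by blast
  have red: "reduced w" using cred by (simp add: cyc_reduced_def)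
  obtain b w1 where w: "w = [] @ b # w1" using ne by (cases w) auto
  from traced_reduced[OF rep red] w show ?thesis
  proof (cases rule: tracedD)
    case (bridge y1 y2 N1 W1 N2 W2)
    then have w': "w = [b] @ y1 @ (inv_letter b # y2)" using w by simp
    then have "y1 \<noteq> []" using red by (auto simp: reduced_Cons)
    moreover have "cyclic_conjugate ((y1 @ (inv_letter b # y2)) @ [b]) ([b] @ y1 @ (inv_letter b # y2))"
      by (rule cyclic_conjugate_rotate)
    ultimately show ?thesis using simple[of y1 "(inv_letter b # y2) @ [b]"] bridge(4) w' by simp
  next
    case (corolla k N' W' c)
    obtain z1 w2 c2 where 1: "w1 = z1 @ w2" "c = z1 @ c2" "w2 \<noteq> [] \<and> c2 \<noteq> [] \<longrightarrow> hd w2 \<noteq> hd c2"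
      using common_prefix_ex by blast
    \<comment> \<open>The common suffix is taken from what the common prefix leaves over, so that
      the two stretches do not overlap.\<close>
    obtain z2 w3 c3 where 2: "w2 = w3 @ z2" "c2 = c3 @ z2" "w3 \<noteq> [] \<and> c3 \<noteq> [] \<longrightarrow> last w3 \<noteq> last c3"
      using common_suffix_ex by blast
    let ?z = "z2 @ b # z1"
    have w': "w = (b # z1 @ w3) @ z2" using w 1 2 by simp
    have conj: "cyclic_conjugate (?z @ w3) w" unfolding w' using cyclic_conjugate_rotate[of z2 "b # z1 @ w3"] by simp
    have cl_rot: "cl (?z @ w3) = cl z2 + cl w + - cl z2" unfolding w' by (simp only: fg_simps)
    have "?z @ w3 \<in> C_set R k"
    proof (rule optimal_rotation_in_C_set)
      show "cyc_reduced (?z @ w3)"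
        using cyc_reduced_rotate[of "b # z1 @ w3" z2] cred w' by simp
      show "?z @ c3 \<in> C_set R k"
        using C_set_rotate[of "b # z1 @ c3" z2 R k] corolla(1) 1 2 by simp
      show "w3 \<noteq> [] \<and> c3 \<noteq> [] \<longrightarrow> hd w3 \<noteq> hd c3" using 1 2 by auto
      show "crep R N' W' (cl (inv_word c3 @ w3))"
        using crep_conj[OF corolla(4), of "cl z2"] unfolding 1 2 by (simp only: fg_simps)
      show "\<not> better (N1, W1) (k + N', 3 ^ k + W')" if "crep R N1 W1 (cl (?z @ w3))" for N1 W1
      proof -
        have "crep R N1 W1 (cl w)"
          using crep_conj[OF that[unfolded cl_rot], of "- cl z2"] by (simp only: fg_simps)
        with opt corolla(2,3) show ?thesis by (simp add: ac_simps)
      qed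
      show "\<not> crep R N W (cl u)" if "cyclic_conjugate (u @ v) (?z @ w3)" "u \<noteq> []" "v \<noteq> []" for u v N W
        using simple cyclic_conjugate_trans[OF that(1) conj] that by blast
    qed (use 2 in auto)
    then have "w \<in> C_set R k" using C_set_rotate[of z2 "b # z1 @ w3" R k] w' by simp
    then show ?thesis ..
  qed
qed

end

section \<open>Area and relators\<close>

lemma conj_product_simps [simp]:
  "conj_product [] = []"
  "conj_product ((t, r) # ps) = t @ r @ inv_word t @ conj_product ps"
  "conj_product (ps @ qs) = conj_product ps @ conj_product qs"
  by (simp_all add: conj_product_def)

text \<open>For a relator, \<open>area\<close> is the least such \<open>k\<close>; leaving
  \<open>k\<close> free lets products be combined before minimizing. Unlike in \<open>crep\<close>,
  conjugators are confined to words over \<open>X\<close>.\<close>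

definition rel_product :: "'a set \<Rightarrow> 'a word set \<Rightarrow> nat \<Rightarrow> 'a fg \<Rightarrow> bool" where
  "rel_product X R k g \<longleftrightarrow>
     (\<exists>ps. set ps \<subseteq> words X \<times> R \<and> length ps = k \<and> g = cl (conj_product ps))"

lemma words_UNIV [simp]: "words UNIV = UNIV"
  by (auto simp: words_def)

lemma rel_product_0: "rel_product X R 0 0"
  by (simp add: rel_product_def cl_Nil)

lemma rel_product_add:
  assumes "rel_product X R k g" "rel_product X R l h"
  shows "rel_product X R (k + l) (g + h)"
proof -
  obtain ps qs where "set ps \<subseteq> words X \<times> R" "length ps = k" "g = cl (conj_product ps)"
    "set qs \<subseteq> words X \<times> R" "length qs = l" "h = cl (conj_product qs)"
    using assms unfolding rel_product_def by blast
  then show ?thesis unfolding rel_product_def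
    by (intro exI[of _ "ps @ qs"]) (simp add: cl_append)
qed

lemma cl_conj_product_map:
  "cl (conj_product (map (\<lambda>(t, r). (x @ t, r)) ps)) = cl x + cl (conj_product ps) + - cl x"
proof (induction ps)
  case (Cons p ps)
  obtain t r where p: "p = (t, r)" by (cases p)
  show ?case
    using Cons unfolding p list.map prod.case conj_product_simps by (simp only: fg_simps)
qed (simp add: cl_Nil)

lemma rel_product_conj:
  assumes "rel_product X R k g" "x \<in> words X"
  shows "rel_product X R k (cl x + g + - cl x)"
proof -
  obtain ps where "set ps \<subseteq> words X \<times> R" "length ps = k" "g = cl (conj_product ps)"
    using assms unfolding rel_product_def by blast
  then show ?thesis unfolding rel_product_def using assms(2)
    by (intro exI[of _ "map (\<lambda>(t, r). (x @ t, r)) ps"]) (auto simp only: cl_conj_product_map, auto)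
qed

lemma rel_product_rel: "r \<in> R \<Longrightarrow> rel_product X R 1 (cl r)"
  unfolding rel_product_def by (intro exI[of _ "[([], r)]"]) simp

lemma crep_rel_product: "rel_product X R k g \<Longrightarrow> \<exists>N W. crep R N W g"
proof -
  have "\<exists>N W. crep R N W (cl (conj_product ps))" if "set ps \<subseteq> words X \<times> R" for ps
    using that
  proof (induction ps)
    case Nil
    then show ?case using crep.zero by (auto simp: cl_Nil)
  next
    case (Cons p ps)
    obtain t r where p: "p = (t, r)" by (cases p)
    obtain N W where "crep R N W (cl (conj_product ps))" using Cons by auto
    moreover have "r \<in> C_set R 1" using Cons.prems p by (auto intro!: bexI[of _ r])
    ultimately have "crep R (N + 1) (W + 3 ^ 1) (cl t + cl r + - cl t + cl (conj_product ps))"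
      by (rule crep.step)
    moreover have "cl t + cl r + - cl t + cl (conj_product ps) = cl (conj_product (p # ps))"
      unfolding p conj_product_simps by (simp only: fg_simps)
    ultimately show ?case by metis
  qed
  then show "rel_product X R k g \<Longrightarrow> ?thesis" unfolding rel_product_def by blast
qed

lemma area_le:
  assumes "rel_product X R k (cl w)" "reduced w"
  shows "area X R w \<le> k"
proof -
  obtain ps where "set ps \<subseteq> words X \<times> R" "length ps = k" "cl w = cl (conj_product ps)"
    using assms unfolding rel_product_def by blast
  then show ?thesis unfolding area_def using assms(2)
    by (intro Least_le exI[of _ ps]) (simp add: cl_eq_iff red_reduced)
qed

lemma rel_product_area:
  assumes "rel_product X R k (cl w)" "reduced w"
  shows "rel_product X R (area X R w) (cl w)"
proof -
  obtain ps where "set ps \<subseteq> words X \<times> R" "length ps = k" "w = red (conj_product ps)"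
    using assms unfolding rel_product_def by (metis cl_eq_iff red_reduced)
  then have "\<exists>k ps. set ps \<subseteq> words X \<times> R \<and> length ps = k \<and> w = red (conj_product ps)" by blast
  from LeastI_ex[OF this] obtain ps where "set ps \<subseteq> words X \<times> R" "length ps = area X R w"
    "w = red (conj_product ps)" unfolding area_def by blast
  then show ?thesis unfolding rel_product_def by (intro exI[of _ ps]) simp
qed

text \<open>A letter and its inverse belong to the same generator, so a cancelling pair is kept or
  deleted as a whole.\<close>

lemma cl_filter_red: "cl (filter (\<lambda>a. fst a \<in> X) (red w)) = cl (filter (\<lambda>a. fst a \<in> X) w)"
proof -
  have "cl (filter (\<lambda>a. fst a \<in> X) ([] @ red w)) = cl (filter (\<lambda>a. fst a \<in> X) w)"
  proof (rule red_induct)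
    fix p q :: "'a word" and a :: "'a \<times> bool"
    have "fst (inv_letter a) = fst a" by (simp add: inv_letter_def)
    moreover assume "cl (filter (\<lambda>a. fst a \<in> X) (p @ a # inv_letter a # q)) = cl (filter (\<lambda>a. fst a \<in> X) w)"
    ultimately show "cl (filter (\<lambda>a. fst a \<in> X) (p @ q)) = cl (filter (\<lambda>a. fst a \<in> X) w)"
      by (cases "fst a \<in> X") (simp_all add: cl_append cl_Cons cl_inv_letter)
  qed simp
  then show ?thesis by simp
qed

lemma filter_words: "filter (\<lambda>a. fst a \<in> X) w \<in> words X"
  by (induction w) auto

lemma filter_words_id: "w \<in> words X \<Longrightarrow> filter (\<lambda>a. fst a \<in> X) w = w"
  by (induction w) auto

lemma filter_inv_word:
  "filter (\<lambda>a. fst a \<in> X) (inv_word w) = inv_word (filter (\<lambda>a. fst a \<in> X) w)"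
  by (induction w) (auto simp: inv_letter_def)

context word_presentation
begin

lemma R_words: "r \<in> R \<Longrightarrow> r \<in> words X"
  using pres by (auto simp: presentation_def)

lemma R_reduced: "r \<in> R \<Longrightarrow> reduced r"
  using pres by (auto simp: presentation_def cyc_reduced_def)

lemma rel_product_uminus:
  assumes "rel_product X R k g"
  shows "rel_product X R k (- g)"
proof -
  have inv: "inv_word r \<in> R" if "r \<in> R" for r using that pres by (auto simp: presentation_def)
  have "cl (conj_product (rev (map (\<lambda>(t, r). (t, inv_word r)) ps))) = - cl (conj_product ps)"
    for ps :: "('a word \<times> 'a word) list"
  proof (induction ps)
    case (Cons p ps)
    obtain t r where p: "p = (t, r)" by (cases p)
    show ?case
      using Cons unfolding p list.map prod.case rev.simps conj_product_simps by (simp only: fg_simps)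
  qed (simp add: cl_Nil)
  with assms inv show ?thesis unfolding rel_product_def
    by (elim exE conjE) (rule exI[of _ "rev (map (\<lambda>(t, r). (t, inv_word r)) _)"], auto)
qed

text \<open>Letters outside \<open>X\<close> in the conjugators are killed by the retraction onto the free group on \<open>X\<close>.\<close>

lemma rel_product_UNIV_imp:
  assumes "rel_product UNIV R k (cl w)" "w \<in> words X"
  shows "rel_product X R k (cl w)"
proof -
  let ?f = "filter (\<lambda>a :: 'a \<times> bool. fst a \<in> X)"
  obtain ps where ps: "set ps \<subseteq> UNIV \<times> R" "length ps = k" "cl w = cl (conj_product ps)"
    using assms unfolding rel_product_def by auto
  have "?f (conj_product ps) = conj_product (map (\<lambda>(t, r). (?f t, r)) ps)"
    using ps(1)
    by (induction ps) (auto simp: filter_words_id filter_inv_word R_words)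
  moreover have "cl w = cl (?f (conj_product ps))"
    using ps(3) assms(2) by (metis cl_eq_iff cl_filter_red filter_words_id)
  ultimately show ?thesis unfolding rel_product_def using ps
    by (intro exI[of _ "map (\<lambda>(t, r). (?f t, r)) ps"]) (auto simp: filter_words)
qed

lemma C_set_rel_product: "c \<in> C_set R k \<Longrightarrow> \<exists>m. rel_product UNIV R m (cl c)"
proof (induction k arbitrary: c)
  case (Suc k)
  have rot: "\<exists>m. rel_product UNIV R m (cl u)" if "cyclic_conjugate u v" "rel_product UNIV R m (cl v)" for u v m
  proof -
    from that obtain p q where v: "v = p @ q" "u = q @ p" by (auto simp: cyclic_conjugate_def)
    have "cl u = cl (inv_word p) + cl v + - cl (inv_word p)" unfolding v by (simp only: fg_simps)
    with rel_product_conj[OF that(2), of "inv_word p"] show ?thesis by auto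
  qed
  have base: "\<exists>m. rel_product UNIV R m (cl c)" if "c \<in> C_set R 1" for c
  proof -
    from that obtain r where "r \<in> R" "cyclic_conjugate c r" by auto
    with rot rel_product_rel show ?thesis by blast
  qed
  from Suc.prems show ?case
  proof (cases rule: C_set_cases)
    case (rel r)
    then show ?thesis using base Suc.prems by simp
  next
    case (prod l u v)
    then obtain m n where "rel_product UNIV R m (cl u)" "rel_product UNIV R n (cl v)"
      using base Suc.IH by blast
    then have 1: "rel_product UNIV R (m + n) (cl (u @ v))" using rel_product_add by (auto simp: cl_append)
    obtain t where t: "cl (u @ v) = t + cl (cyc_prod u v) + - t"
      using cl_cyc_red unfolding cyc_prod_def by blast
    have "cl (cyc_prod u v) = cl (inv_word (rep_fg t)) + cl (u @ v) + - cl (inv_word (rep_fg t))"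
      unfolding t by (simp only: fg_simps cl_rep)
    then have "rel_product UNIV R (m + n) (cl (cyc_prod u v))"
      using rel_product_conj[OF 1, of "inv_word (rep_fg t)"] by simp
    with rot prod show ?thesis by blast
  qed
qed simp

lemma crep_imp_rel_product: "crep R N W g \<Longrightarrow> \<exists>m. rel_product UNIV R m g"
proof (induction rule: crep.induct)
  case (step N W g c k x)
  then obtain m n where m: "rel_product UNIV R m (cl c)" "rel_product UNIV R n g"
    using C_set_rel_product by blast
  from rel_product_add[OF rel_product_conj[OF m(1), of "rep_fg x"] m(2)] show ?case
    by (auto simp: cl_rep)
qed (use rel_product_0 in blast)

lemma rel_product_iff_crep:
  "w \<in> words X \<Longrightarrow> (\<exists>k. rel_product X R k (cl w)) \<longleftrightarrow> (\<exists>N W. crep R N W (cl w))"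
  using crep_rel_product crep_imp_rel_product rel_product_UNIV_imp by blast

lemma C_set_words: "c \<in> C_set R k \<Longrightarrow> c \<in> words X"
proof (induction k arbitrary: c)
  case (Suc k)
  have base: "c \<in> words X" if "c \<in> C_set R 1" for c
    using that R_words by (auto simp: cyclic_conjugate_def) (metis words_simps(3))+
  from Suc.prems show ?case
  proof (cases rule: C_set_cases)
    case (rel r)
    then show ?thesis using base Suc.prems by simp
  next
    case (prod l u v)
    then have "u @ v \<in> words X" using Suc.IH base by auto
    then have "cyc_prod u v \<in> words X"
      unfolding cyc_prod_def by (induction rule: cyc_red_induct) auto
    with prod(5) show ?thesis by (auto simp: cyclic_conjugate_def)
  qed
qed simp

lemma inv_free_group:
  assumes "x \<in> carrier (free_group X)"
  shows "inv\<^bsub>free_group X\<^esub> x = inv_word x"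
proof -
  interpret group "free_group X" by (rule group_free_group)
  show ?thesis
    by (rule inv_equality)
      (use assms in \<open>auto simp: free_group_def red_inv_word reduced_inv_word inv_word_words\<close>)
qed

lemma relators_eq:
  "relators X R = {w \<in> words X. reduced w \<and> (\<exists>k. rel_product X R k (cl w))}" (is "_ = ?N")
proof
  interpret group "free_group X" by (rule group_free_group)
  have "subgroup ?N (free_group X)"
  proof (rule subgroupI)
    show "?N \<noteq> {}" using rel_product_0[of X R] by (auto simp: cl_Nil intro!: exI[of _ "[]"])
    fix w assume w: "w \<in> ?N"
    then have "inv\<^bsub>free_group X\<^esub> w = inv_word w" by (intro inv_free_group) (auto simp: free_group_def)
    then show "inv\<^bsub>free_group X\<^esub> w \<in> ?N"
      using w rel_product_uminus by (auto simp: reduced_inv_word inv_word_words cl_inv_word)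
    fix v assume "v \<in> ?N"
    moreover obtain k l where "rel_product X R k (cl w)" "rel_product X R l (cl v)"
      using w \<open>v \<in> ?N\<close> by blast
    then have "\<exists>m. rel_product X R m (cl w + cl v)" using rel_product_add by blast
    ultimately show "w \<otimes>\<^bsub>free_group X\<^esub> v \<in> ?N"
      using w by (simp add: free_group_def reduced_red red_words cl_append)
  qed (auto simp: free_group_def)
  moreover have "x \<otimes>\<^bsub>free_group X\<^esub> h \<otimes>\<^bsub>free_group X\<^esub> inv\<^bsub>free_group X\<^esub> x \<in> ?N"
    if x: "x \<in> carrier (free_group X)" and h: "h \<in> ?N" for x h
  proof -
    obtain k where "rel_product X R k (cl h)" using h by blast
    from rel_product_conj[OF this, of x] have "rel_product X R k (cl (red (red (x @ h) @ inv_word x)))"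
      using x by (simp add: cl_append cl_inv_word free_group_def)
    with x h show ?thesis unfolding inv_free_group[OF x]
      by (auto simp: free_group_def reduced_red red_words inv_word_words)
  qed
  ultimately have "?N \<lhd> free_group X" by (simp add: normal_inv_iff)
  moreover have "R \<subseteq> ?N" using rel_product_rel R_words R_reduced by fast
  ultimately show "relators X R \<subseteq> ?N" by (auto simp: relators_def normal_closure_def)
next
  show "?N \<subseteq> relators X R"
    unfolding relators_def normal_closure_def
  proof (intro subsetI InterI)
    fix w N assume w: "w \<in> ?N" and "N \<in> {N. N \<lhd> free_group X \<and> R \<subseteq> N}"
    then interpret normal N "free_group X" by simp
    have RN: "R \<subseteq> N" using \<open>N \<in> _\<close> by simp
    have conj: "red (t @ r @ inv_word t) \<in> N" if "t \<in> words X" "r \<in> R" for t r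
    proof -
      have t: "red t \<in> carrier (free_group X)" using that by (simp add: free_group_def reduced_red red_words)
      have "red t \<otimes>\<^bsub>free_group X\<^esub> r \<otimes>\<^bsub>free_group X\<^esub> inv_word (red t) \<in> N"
        using inv_op_closed2[OF t, of r] RN that inv_free_group[OF t] by auto
      also have "red t \<otimes>\<^bsub>free_group X\<^esub> r \<otimes>\<^bsub>free_group X\<^esub> inv_word (red t) = red (t @ r @ inv_word t)"
        unfolding free_group_def
        by (rule cl_eq_reduced) (simp_all add: reduced_red cl_append cl_inv_word add.assoc del: add_uminus_conv_diff)
      finally show ?thesis .
    qed
    have "red (conj_product ps) \<in> N" if "set ps \<subseteq> words X \<times> R" for ps
      using that
    proof (induction ps)
      case Nil
      have "[] \<in> N" using subgroup.one_closed[OF subgroup_axioms] by (simp add: free_group_def)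
      then show ?case by (simp add: red_def)
    next
      case (Cons p ps)
      obtain t r where p: "p = (t, r)" by (cases p)
      have "red (t @ r @ inv_word t) \<otimes>\<^bsub>free_group X\<^esub> red (conj_product ps) \<in> N"
        using Cons conj p by (intro subgroup.m_closed[OF subgroup_axioms]) auto
      also have "red (t @ r @ inv_word t) \<otimes>\<^bsub>free_group X\<^esub> red (conj_product ps) = red (conj_product (p # ps))"
        unfolding free_group_def p
        by (rule cl_eq_reduced) (simp_all add: reduced_red cl_append add.assoc)
      finally show ?case .
    qed
    then show "w \<in> N"
      using w unfolding rel_product_def by (auto simp: cl_eq_iff red_reduced)
  qed
qed

end

section \<open>Passing from proper corollas to all relators\<close>

lemma finite_words_length_le: "finite X \<Longrightarrow> finite {w \<in> words X. length w \<le> n}"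
  using finite_lists_length_le[of "X \<times> (UNIV :: bool set)" n]
  by (auto simp: words_def lists_eq_set intro: rev_finite_subset)

context word_presentation
begin

lemma in_D_relator: "in_D X R k w \<Longrightarrow> w \<in> relators X R"
proof (induction rule: in_D.induct)
  case (conj k w u)
  have "crep R k (3 ^ k) (cl (u @ w @ inv_word u))"
    using crep_conj[OF crep_C_set[OF conj(2)], of "cl u"] by (simp only: fg_simps)
  moreover have "u @ w @ inv_word u \<in> words X"
    using conj C_set_words by (simp add: inv_word_words)
  ultimately show ?case
    using conj rel_product_iff_crep unfolding relators_eq by blast
next
  case (ins i j u v w)
  obtain w1 w2 where w: "v = w1 @ w2" "w = w1 @ u @ w2"
    using ins by (auto simp: insertion_def)
  have "w \<in> words X" using ins.IH w by (simp add: relators_eq)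
  moreover obtain N W N' W' where "crep R N W (cl v)" "crep R N' W' (cl u)"
    using ins.IH crep_rel_product unfolding relators_eq by blast
  then have "crep R N W (cl w1 + cl w2)" "crep R N' W' (cl u)"
    by (simp_all add: w cl_append)
  from crep_insert[OF this] have "\<exists>N W. crep R N W (cl w)" unfolding w by (auto simp: cl_append)
  ultimately show ?case
    using ins rel_product_iff_crep unfolding relators_eq by blast
qed

lemma C_set_in_D:
  assumes "w \<in> C_set R k"
  shows "in_D X R k w"
proof -
  have "in_D X R k ([] @ w @ inv_word [])"
    by (rule in_D.conj) (use assms C_set_pos[OF assms] C_set_reduced[OF assms] in simp_all)
  then show ?thesis by simp
qed

lemma C_set_relator: "w \<in> C_set R k \<Longrightarrow> w \<in> relators X R"
  using C_set_in_D in_D_relator by blast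

lemma area_conj_le:
  assumes "w \<in> relators X R" "x \<in> words X" "reduced v" "cl v = cl x + cl w + - cl x"
  shows "area X R v \<le> area X R w"
proof -
  have "rel_product X R (area X R w) (cl w)"
    using assms(1) rel_product_area unfolding relators_eq by blast
  from rel_product_conj[OF this assms(2)] show ?thesis
    using assms(3,4) area_le by metis
qed

text \<open>The conjugator \<open>x\<close> is there for insertions: \<open>w1 @ u @ w2\<close> is
  the conjugate of \<open>u\<close> by \<open>w1\<close> times \<open>w1 @ w2\<close>.\<close>

lemma area_add_le:
  assumes "u \<in> relators X R" "v \<in> relators X R" "x \<in> words X" "reduced w"
    "cl w = cl x + cl u + - cl x + cl v"
  shows "area X R w \<le> area X R u + area X R v"
proof -
  have "rel_product X R (area X R u) (cl u)" "rel_product X R (area X R v) (cl v)"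
    using assms rel_product_area unfolding relators_eq by blast+
  then have "rel_product X R (area X R u + area X R v) (cl w)"
    unfolding assms(5) using assms(3) by (intro rel_product_add rel_product_conj)
  then show ?thesis using area_le assms(4) by blast
qed

text \<open>The index always drops: a word of \<open>C_set R k\<close> that is no proper corolla
  lies in some \<open>D_set X R h\<close> with \<open>h < k\<close>, and the parts of an insertion
  have smaller positive indices. Lengths add up under insertion, while areas are
  subadditive.\<close>

lemma area_in_D_le:
  fixes \<alpha> :: real
  assumes cor: "\<And>c. proper_corolla X R c \<Longrightarrow> real (area X R c) \<le> \<alpha> * real (length c)"
    and \<alpha>: "\<alpha> > 0"
  shows "in_D X R k w \<Longrightarrow> real (area X R w) \<le> \<alpha> * real (length w)"
proof (induction k arbitrary: w rule: less_induct)
  case (less k)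
  from less.prems less.IH show ?case
  proof (induction rule: in_D.induct)
    case (conj k w u)
    have w: "real (area X R w) \<le> \<alpha> * real (length w)"
    proof (cases "proper_corolla X R w")
      case True
      then show ?thesis by (rule cor)
    next
      case False
      with conj obtain h where "h < k" "in_D X R h w"
        unfolding proper_corolla_def D_set_def by blast
      with conj show ?thesis by blast
    qed
    have "area X R (u @ w @ inv_word u) \<le> area X R w"
      using conj C_set_relator by (intro area_conj_le[where x=u]) (auto simp only: fg_simps)
    then have "real (area X R (u @ w @ inv_word u)) \<le> \<alpha> * real (length w)" using w by linarith
    also have "\<dots> \<le> \<alpha> * real (length (u @ w @ inv_word u))" using \<alpha> by simp
    finally show ?case .
  next
    case (ins i j u v w)
    have uv: "real (area X R u) \<le> \<alpha> * real (length u)" "real (area X R v) \<le> \<alpha> * real (length v)"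
      using ins.prems[of i u] ins.prems[of j v] ins.hyps by auto
    obtain w1 w2 where w: "v = w1 @ w2" "w = w1 @ u @ w2"
      using ins by (auto simp: insertion_def)
    have v: "v \<in> relators X R" using ins in_D_relator by blast
    have "area X R w \<le> area X R u + area X R v"
    proof (rule area_add_le[where x=w1])
      show "w1 \<in> words X" using v w by (simp add: relators_eq)
      show "cl w = cl w1 + cl u + - cl w1 + cl v" unfolding w by (simp only: fg_simps)
    qed (use ins v in_D_relator in auto)
    then show ?case using uv w by (simp add: algebra_simps)
  qed
qed

lemma area_relator_le:
  fixes \<alpha> :: real
  assumes cor: "\<And>c. proper_corolla X R c \<Longrightarrow> real (area X R c) \<le> \<alpha> * real (length c)"
    and \<alpha>: "\<alpha> > 0"
  shows "w \<in> relators X R \<Longrightarrow> real (area X R w) \<le> \<alpha> * real (length w)"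
proof (induction "length w" arbitrary: w rule: less_induct)
  case less
  then have w: "w \<in> words X" "reduced w" "\<exists>k. rel_product X R k (cl w)" by (auto simp: relators_eq)
  consider (empty) "w = []" | (conj) "w \<noteq> []" "\<not> cyc_reduced w"
    | (split) u v where "cyclic_conjugate (u @ v) w" "u \<noteq> []" "v \<noteq> []" "\<exists>N W. crep R N W (cl u)"
    | (simple) "w \<noteq> []" "cyc_reduced w"
        "\<And>u v N W. cyclic_conjugate (u @ v) w \<Longrightarrow> u \<noteq> [] \<Longrightarrow> v \<noteq> [] \<Longrightarrow> \<not> crep R N W (cl u)"
    by metis
  then show ?case
  proof cases
    case empty
    have "area X R [] \<le> 0" using rel_product_0 by (intro area_le) (simp_all add: cl_Nil)
    with empty show ?thesis by simp
  next
    case conj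
    then have h: "hd w = inv_letter (last w)" using w by (simp add: cyc_reduced_def)
    with conj have "tl w \<noteq> []" by (cases w) auto
    then obtain b v where wv: "w = inv_letter b # v @ [b]"
      using h conj by (metis append_butlast_last_id hd_Cons_tl last_tl)
    have v: "v \<in> words X" "reduced v" using w wv by (auto simp: reduced_Cons reduced_append)
    obtain k where "rel_product X R k (cl w)" using w by blast
    from rel_product_conj[OF this, of "[b]"]
    have "rel_product X R k (cl [b] + cl w + - cl [b])" using w wv by simp
    also have "cl [b] + cl w + - cl [b] = cl v" unfolding wv by (simp only: fg_simps)
    finally have "rel_product X R k (cl v)" .
    with v have rv: "v \<in> relators X R" by (auto simp: relators_eq)
    have "area X R w \<le> area X R v"
    proof (rule area_conj_le[OF rv, of "[inv_letter b]"])
      show "cl w = cl [inv_letter b] + cl v + - cl [inv_letter b]" unfolding wv by (simp only: fg_simps)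
    qed (use w wv in auto)
    also have "real (area X R v) \<le> \<alpha> * real (length v)" using less.hyps[of v] rv wv by simp
    also have "\<dots> \<le> \<alpha> * real (length w)" using \<alpha> wv by simp
    finally show ?thesis by simp
  next
    case (split u v)
    then obtain p q where pq: "w = p @ q" "u @ v = q @ p" by (auto simp: cyclic_conjugate_def)
    have "u @ v \<in> words X" using pq w by simp
    then have uv: "u \<in> words X" "v \<in> words X" by auto
    have clw: "cl w = cl p + (cl u + cl v) + - cl p"
      unfolding pq(1) cl_append[of u v, symmetric] pq(2) by (simp only: fg_simps)
    obtain k l where k: "rel_product X R k (cl w)" "rel_product X R l (cl u)"
      using w split uv rel_product_iff_crep by blast
    \<comment> \<open>Cancelling \<open>u\<close> from the rotated relator leaves \<open>v\<close>,
      which is therefore a relator too.\<close>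
    have "rel_product X R k (cl (inv_word p) + cl w + - cl (inv_word p))"
      using k pq w by (intro rel_product_conj) (auto simp: inv_word_words)
    from rel_product_add[OF rel_product_uminus[OF k(2)] this]
    have v': "rel_product X R (l + k) (cl v)" unfolding clw by (simp only: fg_simps)
    have ru: "red u \<in> relators X R" "red v \<in> relators X R"
      using uv k v' by (auto simp: relators_eq reduced_red red_words)
    have len: "length (red x) \<le> length x" for x :: "'a word"
      using red_induct[of "\<lambda>y. length y \<le> length x" "[]" x] by simp
    have luv: "length u + length v = length w" using pq by (metis length_append add.commute)
    have "length u > 0" "length v > 0" using split by auto
    then have "length (red u) < length w" "length (red v) < length w"
      using len[of u] len[of v] luv by linarith+
    have ruv: "red (u @ v) \<in> relators X R"
      using rel_product_add[OF k(2) v'] uv by (auto simp: relators_eq reduced_red red_words cl_append)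
    have "area X R w \<le> area X R (red (u @ v))"
    proof (rule area_conj_le[OF ruv])
      show "cl w = cl p + cl (red (u @ v)) + - cl p" by (simp only: clw cl_red fg_simps)
    qed (use w pq in auto)
    also have "\<dots> \<le> area X R (red u) + area X R (red v)"
    proof (rule area_add_le[OF ru])
      show "cl (red (u @ v)) = cl [] + cl (red u) + - cl [] + cl (red v)" by (simp only: cl_red fg_simps)
    qed (simp_all add: reduced_red)
    finally have "real (area X R w) \<le> real (area X R (red u)) + real (area X R (red v))" by linarith
    also have "\<dots> \<le> \<alpha> * real (length (red u)) + \<alpha> * real (length (red v))"
      using less.hyps ru \<open>length (red u) < length w\<close> \<open>length (red v) < length w\<close>
      by (intro add_mono) auto
    also have "\<dots> \<le> \<alpha> * real (length w)"
      using len[of u] len[of v] luv \<alpha> by (simp flip: distrib_left)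
    finally show ?thesis .
  next
    case simple
    then obtain k where "w \<in> C_set R k"
      using simple_relator_in_C_set[of w] w rel_product_iff_crep by blast
    then show ?thesis using area_in_D_le[OF cor \<alpha>] C_set_in_D by blast
  qed
qed

end

theorem corollary4p1p5:
  fixes X :: "'a set" and R :: "'a word set" and \<alpha> :: real
  assumes "finite X"
    and "presentation X R"
    and "\<alpha> > 0"
  shows "(\<forall>n. real (dehn X R n) \<le> \<alpha> * real n) \<longleftrightarrow>
         (\<forall>n. real (corolla_dehn X R n) \<le> \<alpha> * real n)"
proof -
  interpret word_presentation X R by unfold_locales (rule assms)
  have rel_words: "w \<in> words X" if "w \<in> relators X R" for w
    using that by (simp add: relators_eq)
  have cor_rel: "c \<in> relators X R" if "proper_corolla X R c" for c
    using that C_set_relator unfolding proper_corolla_def by blast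
  have fin: "finite {area X R w | w. P w \<and> length w \<le> n}" if "\<And>w. P w \<Longrightarrow> w \<in> relators X R" for P n
  proof -
    have "{area X R w | w. P w \<and> length w \<le> n} \<subseteq> area X R ` {w \<in> words X. length w \<le> n}"
      using that rel_words by blast
    then show ?thesis using finite_words_length_le[OF assms(1)] finite_surj by blast
  qed
  have dehn_iff: "real (dehn X R n) \<le> x \<longleftrightarrow>
      (\<forall>w. w \<in> relators X R \<and> length w \<le> n \<longrightarrow> real (area X R w) \<le> x)" for n x
  proof -
    let ?S = "{area X R w | w. w \<in> relators X R \<and> length w \<le> n}"
    have "[] \<in> relators X R" using rel_product_0 by (auto simp: relators_eq cl_Nil)
    then have "?S \<noteq> {}" by (auto intro!: exI[of _ "[]"])
    moreover have "finite ?S" by (rule fin)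
    ultimately have mem: "dehn X R n \<in> ?S" and ge: "\<And>a. a \<in> ?S \<Longrightarrow> a \<le> dehn X R n"
      unfolding dehn_def by (rule Max_in[rotated], simp_all)
    show ?thesis
    proof (intro iffI allI impI)
      fix w assume "real (dehn X R n) \<le> x" "w \<in> relators X R \<and> length w \<le> n"
      moreover from this(2) have "area X R w \<le> dehn X R n" by (intro ge) blast
      ultimately show "real (area X R w) \<le> x" by linarith
    qed (use mem in auto)
  qed
  show ?thesis
  proof
    assume dehn: "\<forall>n. real (dehn X R n) \<le> \<alpha> * real n"
    show "\<forall>n. real (corolla_dehn X R n) \<le> \<alpha> * real n"
    proof
      fix n
      let ?S = "insert 0 {area X R c | c. proper_corolla X R c \<and> length c \<le> n}"
      have "corolla_dehn X R n \<in> ?S"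
        unfolding corolla_dehn_def using fin[OF cor_rel] by (intro Max_in) auto
      \<comment> \<open>The maximum may be the default value 0, for which the bound follows from
        \<open>\<alpha> > 0\<close>.\<close>
      then show "real (corolla_dehn X R n) \<le> \<alpha> * real n"
        using dehn cor_rel assms(3) unfolding dehn_iff by auto
    qed
  next
    assume cor: "\<forall>n. real (corolla_dehn X R n) \<le> \<alpha> * real n"
    have "real (area X R c) \<le> \<alpha> * real (length c)" if "proper_corolla X R c" for c
    proof -
      have "area X R c \<le> corolla_dehn X R (length c)"
        unfolding corolla_dehn_def using fin[OF cor_rel] that by (intro Max_ge) auto
      with cor[rule_format, of "length c"] show ?thesis by linarith
    qed
    from area_relator_le[OF this assms(3)]
    have "real (area X R w) \<le> \<alpha> * real n" if "w \<in> relators X R" "length w \<le> n" for w n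
      using that assms(3) by (smt (verit) mult_left_mono of_nat_mono)
    then show "\<forall>n. real (dehn X R n) \<le> \<alpha> * real n" unfolding dehn_iff by blast
  qed
qed

end
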